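(* Let $n,m\ge1$ be integers, let $f,g_1,\dots,g_m\in\mathbb{R}[\bar z,z]$ be real-valued complex polynomials on $\mathbb{C}^n$, and let $K=\{z\in\mathbb{C}^n : g_i(z)\ge0,\ i=1,\dots,m\}$ be compact. Let $h_1,\dots,h_e\in\mathbb{R}[\bar z,z]$ ($e\ge1$) be such that the equality constraints $h_1=0,\dots,h_e=0$ are among the constraints defining $K$ (each $h_j=0$ being enforced by two opposite inequalities, so that both $h_j$ and $-h_j$ occur among the $g_i$), and assume that there exist $r_1,\dots,r_e\in\mathbb{R}[\bar z,z]$, $\sigma\in\Sigma[z]$ and $a\in\mathbb{R}$ such that $$\sum_{j=1}^e r_j(z)h_j(z)=\sum_{i=1}^n|z_i|^2+\sigma(z)+a,\qquad\forall z\in\mathbb{C}^n.$$ Assume that $z^{\mathrm{opt}}\in K$ is a global minimizer of $f$ on $K$, and that $(\sigma_0^{\mathrm{opt}},\dots,\sigma_m^{\mathrm{opt}})\in\Sigma[z]^{m+1}$ is (together with the optimal value $\lambda$) an optimal solution to $$\sup_{\lambda,\sigma}\ \lambda\quad\text{s.t.}\quad f-\lambda=\sum_{i=0}^m\sigma_ig_i,\ \lambda\in\mathbb{R},\ \sigma_i\in\Sigma[z],\ i=0,\dots,m,$$ where $g_0:=1$. Then $$\nabla f(z^{\mathrm{opt}})=\sum_{i=1}^m\sigma_i^{\mathrm{opt}}(z^{\mathrm{opt}})\,\nabla g_i(z^{\mathrm{opt}}),$$ and for $i=1,\dots,m$: $\sigma_i^{\mathrm{opt}}(z^{\mathrm{opt}})\ge0$,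 $g_i(z^{\mathrm{opt}})\ge0$, and $\sigma_i^{\mathrm{opt}}(z^{\mathrm{opt}})\,g_i(z^{\mathrm{opt}})=0$.
   Context: $\mathbb{R}[\bar z,z]$ is the set of functions $\mathbb{C}^n\to\mathbb{C}$ of the form $\sum_{|\alpha|,|\beta|\le l}\varphi_{\alpha,\beta}\bar z^\alpha z^\beta$ ($l\in\mathbb{N}$, $\varphi_{\alpha,\beta}\in\mathbb{C}$, $z^\alpha=z_1^{\alpha_1}\cdots z_n^{\alpha_n}$) that are real-valued on $\mathbb{C}^n$. $\Sigma[z]$ is the set of finite sums $\sum_{j=1}^r|p_j|^2$, $r\ge1$, where each $p_j$ is a holomorphic polynomial $\sum_{|\alpha|\le l}p_{j,\alpha}z^\alpha$ with complex coefficients. Wirtinger derivative: for $\varphi:\mathbb{C}^n\to\mathbb{R}$ put $\tilde\varphi(x,y):=\varphi(x+\mathbf{i}y)$ for $(x,y)\in\mathbb{R}^{2n}$; if $\tilde\varphi$ is $\mathbb{R}$-differentiable at $(x,y)$, then $\nabla\varphi(x+\mathbf{i}y):=\frac12\big(\nabla_x\tilde\varphi(x,y)-\mathbf{i}\nabla_y\tilde\varphi(x,y)\big)\in\mathbb{C}^n$. *)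

theory Defs
  imports "HOL-Analysis.Analysis"
begin

definition mdeg :: "('n::finite \<Rightarrow> nat) \<Rightarrow> nat" where
  "mdeg \<alpha> = (\<Sum>i\<in>UNIV. \<alpha> i)"

definition mpow :: "complex ^ 'n \<Rightarrow> ('n::finite \<Rightarrow> nat) \<Rightarrow> complex" where
  "mpow z \<alpha> = (\<Prod>i\<in>UNIV. (z $ i) ^ \<alpha> i)"

text \<open>The real-valued complex polynomials: functions \<open>\<phi>\<close> from \<open>\<complex>\<^sup>n\<close> to \<open>\<real>\<close> that, read in
  \<open>\<complex>\<close>, are a finite combination of the monomials in \<open>cnj z\<close> and \<open>z\<close>.  Being real-valued
  is expressed by the codomain.\<close>

definition real_cpoly :: "(complex ^ 'n::finite \<Rightarrow> real) set" where
  "real_cpoly = {\<phi>. \<exists>l c. \<forall>z. complex_of_real (\<phi> z) =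
     (\<Sum>\<alpha> | mdeg \<alpha> \<le> l. \<Sum>\<beta> | mdeg \<beta> \<le> l. c \<alpha> \<beta> * cnj (mpow z \<alpha>) * mpow z \<beta>)}"

definition hol_poly :: "(complex ^ 'n::finite \<Rightarrow> complex) set" where
  "hol_poly = {p. \<exists>l c. \<forall>z. p z = (\<Sum>\<alpha> | mdeg \<alpha> \<le> l. c \<alpha> * mpow z \<alpha>)}"

definition herm_sos :: "(complex ^ 'n::finite \<Rightarrow> real) set" where
  "herm_sos = {\<sigma>. \<exists>(r::nat) p. 1 \<le> r \<and> (\<forall>j\<in>{1..r}. p j \<in> hol_poly) \<and>
     (\<forall>z. \<sigma> z = (\<Sum>j=1..r. (cmod (p j z))\<^sup>2))}"

definition of_parts :: "(real ^ 'n) \<times> (real ^ 'n) \<Rightarrow> complex ^ 'n::finite" where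
  "of_parts = (\<lambda>(x, y). \<chi> i. Complex (x $ i) (y $ i))"

text \<open>The \<open>i\<close>-th components of the gradients in \<open>x\<close> and in \<open>y\<close> are the values of the
  real derivative of \<open>\<phi> \<circ> of_parts\<close> at the unit vectors \<open>(axis i 1, 0)\<close> and \<open>(0, axis i 1)\<close>.
  The definition is meaningful where \<open>\<phi> \<circ> of_parts\<close> is differentiable.\<close>

definition wirtinger :: "(complex ^ 'n::finite \<Rightarrow> real) \<Rightarrow> complex ^ 'n \<Rightarrow> complex ^ 'n" where
  "wirtinger \<phi> z =
     (let D = frechet_derivative (\<phi> \<circ> of_parts) (at (\<chi> i. Re (z $ i), \<chi> i. Im (z $ i)))
      in \<chi> i. (1 / 2) * (complex_of_real (D (axis i 1, 0)) - \<i> * complex_of_real (D (0, axis i 1))))"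

lemma finite_mdeg_le: "finite {\<alpha> :: 'n::finite \<Rightarrow> nat. mdeg \<alpha> \<le> l}"
proof (rule finite_subset)
  show "{\<alpha> :: 'n \<Rightarrow> nat. mdeg \<alpha> \<le> l} \<subseteq> UNIV \<rightarrow>\<^sub>E {..l}"
    unfolding mdeg_def PiE_UNIV_domain
    by (auto intro: order_trans[OF member_le_sum[of _ UNIV]])
qed (auto intro: finite_PiE)

lemma real_cpoly_differentiable:
  assumes "\<phi> \<in> real_cpoly"
  shows "(\<phi> \<circ> of_parts) differentiable (at p)"
proof -
  obtain l c where c: "\<And>z. complex_of_real (\<phi> z) =
     (\<Sum>\<alpha> | mdeg \<alpha> \<le> l. \<Sum>\<beta> | mdeg \<beta> \<le> l. c \<alpha> \<beta> * cnj (mpow z \<alpha>) * mpow z \<beta>)"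
    using assms unfolding real_cpoly_def by blast
  have comp: "(\<lambda>q. of_parts q $ i) differentiable (at p)" for i
    by (rule bounded_linear_imp_differentiable)
       (auto simp: of_parts_def complex_eq_iff case_prod_beta algebra_simps
          intro!: linear_conv_bounded_linear[THEN iffD1] linearI)
  have "\<exists>D. ((\<lambda>q. of_parts q $ i) has_derivative D) (at p)" for i
    using comp unfolding differentiable_def .
  then obtain D where D: "\<And>i. ((\<lambda>q. of_parts q $ i) has_derivative D i) (at p)"
    by metis
  have mono: "(\<lambda>q. mpow (of_parts q) \<alpha>) differentiable (at p)" for \<alpha>
    unfolding mpow_def differentiable_def
    by (rule exI, rule has_derivative_prod) (rule has_derivative_power[OF D])
  have cmono: "(\<lambda>q. cnj (mpow (of_parts q) \<alpha>)) differentiable (at p)" for \<alpha>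
    using mono[of \<alpha>] unfolding differentiable_def
    by (elim exE) (rule exI, erule bounded_linear.has_derivative[OF bounded_linear_cnj])
  have "(\<lambda>q. complex_of_real (\<phi> (of_parts q))) differentiable (at p)"
    unfolding c by (intro ballI differentiable_sum differentiable_mult mono cmono differentiable_const finite_mdeg_le)
  then have "(\<lambda>q. Re (complex_of_real (\<phi> (of_parts q)))) differentiable (at p)"
    unfolding differentiable_def by (elim exE) (rule exI, erule bounded_linear.has_derivative[OF bounded_linear_Re])
  then show ?thesis by (simp add: o_def)
qed

text \<open>Feasibility of \<open>(\<lambda>, \<sigma>\<^sub>0, \<dots>, \<sigma>\<^sub>m)\<close> in the sum-of-squares program, with the
  convention that \<open>g\<^sub>0\<close> is the constant 1, whatever the value of \<open>g 0\<close>.\<close>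

definition sos_feasible ::
  "(complex ^ 'n::finite \<Rightarrow> real) \<Rightarrow> nat \<Rightarrow> (nat \<Rightarrow> complex ^ 'n \<Rightarrow> real) \<Rightarrow>
   real \<Rightarrow> (nat \<Rightarrow> complex ^ 'n \<Rightarrow> real) \<Rightarrow> bool" where
  "sos_feasible f m g lam \<sigma> \<longleftrightarrow>
     (\<forall>i\<in>{0..m}. \<sigma> i \<in> herm_sos) \<and>
     (\<forall>z. f z - lam = (\<Sum>i=0..m. \<sigma> i z * (g(0 := \<lambda>_. 1)) i z))"

definition sos_optimal ::
  "(complex ^ 'n::finite \<Rightarrow> real) \<Rightarrow> nat \<Rightarrow> (nat \<Rightarrow> complex ^ 'n \<Rightarrow> real) \<Rightarrow>
   real \<Rightarrow> (nat \<Rightarrow> complex ^ 'n \<Rightarrow> real) \<Rightarrow> bool" where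
  "sos_optimal f m g lam \<sigma> \<longleftrightarrow>
     sos_feasible f m g lam \<sigma> \<and>
     (\<forall>lam' \<sigma>'. sos_feasible f m g lam' \<sigma>' \<longrightarrow> lam' \<le> lam)"

end

theory Submission
  imports Defs "HOL-Library.Function_Algebras"
begin

text \<open>By a Hermitian Positivstellensatz, \<open>f - f zopt + \<epsilon>\<close> lies in the module
  \<open>{\<Sum>i. \<sigma> i * g i}\<close> for every \<open>\<epsilon> > 0\<close>, so the optimal value \<open>lam\<close> is at least \<open>f zopt\<close>.
  Evaluating \<open>f - lam = (\<Sum>i. \<sigma>opt i * g i)\<close> at \<open>zopt\<close> forces every summand to vanish there.
  Where \<open>\<sigma>opt i\<close> vanishes it is globally minimal, so its gradient vanishes too, and the product
  rule gives the gradient identity.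

  The Positivstellensatz is the representation theorem for modules over an Archimedean semiring
  (Kadison, Dubois, Jacobi): a maximal proper semimodule defines a real character, and the
  characters of the algebra of real-valued complex polynomials are the point evaluations.
  The relation \<open>\<Sum>j. r j * h j = \<bar>z\<bar>\<^sup>2 + \<sigma> + a\<close> shows that \<open>- a - \<bar>z\<bar>\<^sup>2\<close> is a sum of Hermitian squares
  modulo the ideal of the \<open>h j\<close>, which is the Archimedean property.\<close>

section \<open>Modules over an Archimedean semiring\<close>

text \<open>The algebra is a subset \<open>A\<close> of a ring type, since polynomials will form
  only a subset of all functions. \<open>c\<close> embeds the real constants, and
  \<open>arch\<close> bounds every element of \<open>A\<close> from above by a constant modulo
  \<open>S\<close>.\<close>

locale archimedean_semiring =
  fixes c :: "real \<Rightarrow> 'a::comm_ring_1" and A S :: "'a set"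
  assumes c_add: "c (x + y) = c x + c y"
    and c_mult: "c (x * y) = c x * c y"
    and c_1: "c 1 = 1"
    and A_c: "c x \<in> A"
    and A_add: "a \<in> A \<Longrightarrow> b \<in> A \<Longrightarrow> a + b \<in> A"
    and A_mult: "a \<in> A \<Longrightarrow> b \<in> A \<Longrightarrow> a * b \<in> A"
    and S_A: "s \<in> S \<Longrightarrow> s \<in> A"
    and S_c: "0 \<le> x \<Longrightarrow> c x \<in> S"
    and S_add: "s \<in> S \<Longrightarrow> t \<in> S \<Longrightarrow> s + t \<in> S"
    and S_mult: "s \<in> S \<Longrightarrow> t \<in> S \<Longrightarrow> s * t \<in> S"
    and arch: "a \<in> A \<Longrightarrow> \<exists>k. c k - a \<in> S"
begin

lemma c_0: "c 0 = 0"
  using c_add[of 0 0] by simp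

lemma c_minus: "c (- x) = - c x"
  using c_add[of x "- x"] by (simp add: c_0 eq_neg_iff_add_eq_0 add.commute)

lemma c_diff: "c (x - y) = c x - c y"
  using c_add[of x "- y"] by (simp add: c_minus)

lemma A_uminus: "a \<in> A \<Longrightarrow> - a \<in> A"
  using A_mult[OF A_c[of "- 1"], of a] by (simp add: c_minus c_1)

lemma A_diff: "a \<in> A \<Longrightarrow> b \<in> A \<Longrightarrow> a - b \<in> A"
  using A_add[of a "- b"] A_uminus[of b] by simp

text \<open>Raising the bound adds a nonnegative constant, which lies in \<open>S\<close>. Later
  arguments divide by this bound, hence the strict positivity.\<close>

lemma arch_pos:
  assumes "a \<in> A"
  obtains k where "0 < k" "c k - a \<in> S"
proof -
  obtain k where k: "c k - a \<in> S" using arch[OF assms] by blast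
  have "c (max k 1 - k) + (c k - a) \<in> S" using k by (intro S_add S_c) auto
  moreover have "c (max k 1 - k) + (c k - a) = c (max k 1) - a" by (simp add: c_diff)
  ultimately show ?thesis using that[of "max k 1"] by simp
qed

section \<open>Semimodules and their characters\<close>

definition semimodule :: "'a set \<Rightarrow> bool" where
  "semimodule M \<longleftrightarrow> M \<subseteq> A \<and> 1 \<in> M \<and> (\<forall>p\<in>M. \<forall>q\<in>M. p + q \<in> M) \<and> (\<forall>s\<in>S. \<forall>p\<in>M. s * p \<in> M)"

definition positive_character :: "'a set \<Rightarrow> ('a \<Rightarrow> real) \<Rightarrow> bool" where
  "positive_character M \<phi> \<longleftrightarrow>
     (\<forall>a\<in>A. \<forall>b\<in>A. \<phi> (a + b) = \<phi> a + \<phi> b \<and> \<phi> (a * b) = \<phi> a * \<phi> b) \<and>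
     (\<forall>x. \<phi> (c x) = x) \<and> (\<forall>p\<in>M. 0 \<le> \<phi> p)"

lemma semimodule_A: "semimodule M \<Longrightarrow> p \<in> M \<Longrightarrow> p \<in> A"
  and semimodule_1: "semimodule M \<Longrightarrow> 1 \<in> M"
  and semimodule_add: "semimodule M \<Longrightarrow> p \<in> M \<Longrightarrow> q \<in> M \<Longrightarrow> p + q \<in> M"
  and semimodule_mult: "semimodule M \<Longrightarrow> s \<in> S \<Longrightarrow> p \<in> M \<Longrightarrow> s * p \<in> M"
  unfolding semimodule_def by blast+

lemma semimodule_S: "semimodule M \<Longrightarrow> s \<in> S \<Longrightarrow> s \<in> M"
  using semimodule_mult[of M s 1] by (simp add: semimodule_1)

lemma semimodule_c: "semimodule M \<Longrightarrow> 0 \<le> x \<Longrightarrow> c x \<in> M"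
  by (rule semimodule_S[OF _ S_c])

lemma semimodule_c_neg:
  assumes "semimodule M" "c x \<in> M" "x < 0"
  shows "- 1 \<in> M"
proof -
  have "c (- (1 / x)) * c x \<in> M"
    using assms by (intro semimodule_mult S_c) auto
  then show ?thesis using assms(3) by (simp add: c_mult[symmetric] c_minus c_1)
qed

text \<open>This is the semimodule generated by \<open>M\<close> and \<open>b\<close>. It serves to
  enlarge a candidate for maximality, and to refute the positivity of an element by adjoining its
  negative.\<close>

lemma semimodule_adjoin:
  assumes M: "semimodule M" and b: "b \<in> A"
  shows "semimodule {p + b * s | p s. p \<in> M \<and> s \<in> S}" (is "semimodule ?N")
proof -
  have "1 = 1 + b * c 0" by (simp add: c_0)
  then have "1 \<in> ?N" using semimodule_1[OF M] S_c[of 0] by blast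
  moreover have "x + y \<in> ?N" if "x \<in> ?N" "y \<in> ?N" for x y
  proof -
    from that obtain p s q t where *: "x = p + b * s" "y = q + b * t" "p \<in> M" "q \<in> M" "s \<in> S" "t \<in> S"
      by blast
    then have "x + y = (p + q) + b * (s + t)" by (simp add: algebra_simps)
    then show ?thesis using * semimodule_add[OF M] S_add by blast
  qed
  moreover have "u * x \<in> ?N" if "u \<in> S" "x \<in> ?N" for u x
  proof -
    from that obtain p s where *: "x = p + b * s" "p \<in> M" "s \<in> S" by blast
    then have "u * x = u * p + b * (u * s)" by (simp add: algebra_simps)
    then show ?thesis using * that semimodule_mult[OF M] S_mult by blast
  qed
  moreover have "?N \<subseteq> A"
  proof
    fix x assume "x \<in> ?N"
    then obtain p s where "x = p + b * s" "p \<in> M" "s \<in> S" by blast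
    then show "x \<in> A" using semimodule_A[OF M] A_add A_mult b S_A by simp
  qed
  ultimately show ?thesis unfolding semimodule_def by (intro conjI ballI) simp_all
qed

text \<open>The Archimedean property writes \<open>b\<close> as the difference of \<open>c k\<close>
  and \<open>c k - b\<close>, both in \<open>S\<close>. The first acts on \<open>p\<close>, the
  second on \<open>- p\<close>, and the terms \<open>c k * p\<close> cancel.\<close>

lemma semimodule_support_ideal:
  assumes M: "semimodule M" and p: "p \<in> M" "- p \<in> M" and b: "b \<in> A"
  shows "b * p \<in> M"
proof -
  obtain k where k: "0 < k" "c k - b \<in> S" using arch_pos[OF b] .
  have "c k * p + (c k - b) * (- p) \<in> M"
    using k p by (intro semimodule_add semimodule_mult M S_c) auto
  then show ?thesis by (simp add: algebra_simps)
qed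

section \<open>Maximal proper semimodules\<close>

text \<open>Zorn's lemma applies because properness is the exclusion of the single element
  \<open>- 1\<close>, which survives unions of chains, and any two elements of such a union lie in a
  common member.\<close>

lemma maximal_semimodule_exists:
  assumes M: "semimodule M" "- 1 \<notin> M"
  obtains N where "semimodule N" "- 1 \<notin> N" "M \<subseteq> N"
    "\<And>N'. semimodule N' \<Longrightarrow> - 1 \<notin> N' \<Longrightarrow> N \<subseteq> N' \<Longrightarrow> N' = N"
proof -
  let ?F = "{N. semimodule N \<and> - 1 \<notin> N \<and> M \<subseteq> N}"
  have "\<exists>N\<in>?F. \<forall>X\<in>?F. N \<subseteq> X \<longrightarrow> X = N"
  proof (rule subset_Zorn_nonempty)
    show "?F \<noteq> {}" using M by blast
  next
    fix C assume C: "C \<noteq> {}" "subset.chain ?F C"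
    then have sub: "C \<subseteq> ?F" and lin: "\<And>X Y. X \<in> C \<Longrightarrow> Y \<in> C \<Longrightarrow> X \<subseteq> Y \<or> Y \<subseteq> X"
      by (auto simp: subset_chain_def)
    have sm: "semimodule X" if "X \<in> C" for X using sub that by blast
    have "p + q \<in> \<Union>C" if "p \<in> \<Union>C" "q \<in> \<Union>C" for p q
    proof -
      from that obtain X Y where XY: "X \<in> C" "Y \<in> C" "p \<in> X" "q \<in> Y" by blast
      with lin[of X Y] obtain Z where "Z \<in> C" "p \<in> Z" "q \<in> Z" by blast
      with semimodule_add[OF sm] show ?thesis by blast
    qed
    moreover have "s * p \<in> \<Union>C" if "s \<in> S" "p \<in> \<Union>C" for s p
      using that semimodule_mult[OF sm] by blast
    moreover have "\<Union>C \<subseteq> A" using semimodule_A[OF sm] by blast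
    moreover have "1 \<in> \<Union>C" using semimodule_1[OF sm] C(1) by blast
    ultimately have "semimodule (\<Union>C)" unfolding semimodule_def by blast
    then show "\<Union>C \<in> ?F" using C(1) sub by blast
  qed
  then obtain N where N: "N \<in> ?F" "\<forall>X\<in>?F. N \<subseteq> X \<longrightarrow> X = N" by blast
  show ?thesis
  proof (rule that[of N])
    fix N' assume "semimodule N'" "- 1 \<notin> N'" "N \<subseteq> N'"
    with N show "N' = N" by blast
  qed (use N in auto)
qed

text \<open>If neither \<open>b\<close> nor \<open>- b\<close> lies in \<open>N\<close>, maximality gives \<open>- 1 = p + b s = q - b t\<close>;
  eliminating \<open>b\<close> puts \<open>s\<close> into the support \<open>N \<inter> - N\<close>, an ideal, so that \<open>- 1 \<in> N\<close>.\<close>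

lemma maximal_semimodule_total:
  assumes N: "semimodule N" "- 1 \<notin> N"
    and max: "\<And>N'. semimodule N' \<Longrightarrow> - 1 \<notin> N' \<Longrightarrow> N \<subseteq> N' \<Longrightarrow> N' = N"
    and b: "b \<in> A"
  shows "b \<in> N \<or> - b \<in> N"
proof (rule ccontr)
  assume contra: "\<not> (b \<in> N \<or> - b \<in> N)"
  have ex: "\<exists>p s. - 1 = p + d * s \<and> p \<in> N \<and> s \<in> S" if d: "d \<in> A" "d \<notin> N" for d
  proof (rule ccontr)
    let ?N = "{p + d * s | p s. p \<in> N \<and> s \<in> S}"
    assume "\<nexists>p s. - 1 = p + d * s \<and> p \<in> N \<and> s \<in> S"
    then have "- 1 \<notin> ?N" by blast
    moreover have "p \<in> ?N" if "p \<in> N" for p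
    proof -
      have "p = p + d * c 0" by (simp add: c_0)
      then show ?thesis using that S_c[of 0] by blast
    qed
    ultimately have "?N = N" using max[OF semimodule_adjoin[OF N(1) d(1)]] by blast
    moreover have "d = 0 + d * 1" "0 \<in> N" "1 \<in> S"
      using semimodule_c[OF N(1), of 0] S_c[of 1] by (simp_all add: c_0 c_1)
    ultimately show False using d(2) by blast
  qed
  obtain p s where p: "- 1 = p + b * s" "p \<in> N" "s \<in> S" using ex[OF b] contra by blast
  obtain q t where q: "- 1 = q + (- b) * t" "q \<in> N" "t \<in> S"
    using ex[OF A_uminus[OF b]] contra by blast
  have "t * p + s * q + t \<in> N"
    using p q N by (intro semimodule_add semimodule_mult) (auto intro: semimodule_S)
  moreover have "t * p + s * q + t = - s"
  proof -
    have p': "p = - 1 - b * s" using p(1) by simp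
    have q': "q = - 1 + b * t" using q(1) by simp
    show ?thesis unfolding p' q' by (simp add: algebra_simps)
  qed
  ultimately have "- s \<in> N" by simp
  then have "b * s \<in> N" using semimodule_support_ideal[OF N(1)] semimodule_S[OF N(1)] p(3) b by blast
  then have "- 1 \<in> N" unfolding p(1) using p(2) N(1) semimodule_add by blast
  then show False using N(2) by blast
qed

text \<open>In a maximal proper semimodule every element has a unique position on the real line;
  this position is the value of the character.\<close>

theorem positive_character_exists:
  assumes M: "semimodule M" "- 1 \<notin> M"
  obtains \<phi> where "positive_character M \<phi>"
proof -
  obtain N where N: "semimodule N" "- 1 \<notin> N" and MN: "M \<subseteq> N"
    and max: "\<And>N'. semimodule N' \<Longrightarrow> - 1 \<notin> N' \<Longrightarrow> N \<subseteq> N' \<Longrightarrow> N' = N"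
    using maximal_semimodule_exists[OF M] by blast
  have total: "b \<in> N \<or> - b \<in> N" if "b \<in> A" for b
    using maximal_semimodule_total[OF N _ that] max by blast
  have c_N: "0 \<le> x" if "c x \<in> N" for x
    using semimodule_c_neg[OF N(1) that] N(2) by force
  \<comment> \<open>The infimum of the constants lying above \<open>a\<close> modulo
    \<open>N\<close>. The Archimedean property, applied to \<open>a\<close> and to
    \<open>- a\<close>, makes this set nonempty and bounded below.\<close>
  define \<phi> where "\<phi> a = Inf {r. c r - a \<in> N}" for a
  have bound: "r' \<le> r" if "c r - a \<in> N" "a - c r' \<in> N" for a r r'
  proof -
    have "c (r - r') \<in> N" using semimodule_add[OF N(1) that] by (simp add: c_diff)
    then show ?thesis using c_N by fastforce
  qed
  have ne: "{r. c r - a \<in> N} \<noteq> {}" if "a \<in> A" for a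
    using arch[OF that] semimodule_S[OF N(1)] by blast
  have bdd: "bdd_below {r. c r - a \<in> N}" if a: "a \<in> A" for a
  proof -
    obtain k where "c k - (- a) \<in> S" using arch[OF A_uminus[OF a]] by blast
    then have "a - c (- k) \<in> N" using semimodule_S[OF N(1)] by (simp add: c_minus add.commute)
    then show ?thesis using bound by (intro bdd_belowI[of _ "- k"]) blast
  qed
  have upper: "\<phi> a \<le> r" if "a \<in> A" "c r - a \<in> N" for a r
    unfolding \<phi>_def using that bdd by (intro cInf_lower) auto
  have lower: "r \<le> \<phi> a" if "a \<in> A" "a - c r \<in> N" for a r
    unfolding \<phi>_def using that ne bound by (intro cInf_greatest) auto
  have above: "c r - a \<in> N" if a: "a \<in> A" and r: "\<phi> a < r" for a r
  proof -
    obtain r' where r': "c r' - a \<in> N" "r' < r"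
      using r cInf_lessD[OF ne[OF a]] unfolding \<phi>_def by blast
    have "c (r - r') + (c r' - a) \<in> N"
      using r' N(1) by (intro semimodule_add semimodule_c) auto
    then show ?thesis by (simp add: c_diff)
  qed
  have below: "a - c r \<in> N" if a: "a \<in> A" and r: "r < \<phi> a" for a r
  proof -
    \<comment> \<open>A constant below the infimum does not lie above \<open>a\<close>, so totality
      of \<open>N\<close> places it below \<open>a\<close>.\<close>
    have "c r - a \<notin> N" using upper[OF a] r by force
    then show ?thesis using total[OF A_diff[OF A_c a], of r] by simp
  qed
  have \<phi>_c: "\<phi> (c x) = x" for x
    using upper[OF A_c, of x x] lower[OF A_c, of x x] semimodule_c[OF N(1), of 0]
    by (simp add: c_0)
  have add: "\<phi> (a + b) = \<phi> a + \<phi> b" if ab: "a \<in> A" "b \<in> A" for a b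
  proof (rule antisym)
    show "\<phi> (a + b) \<le> \<phi> a + \<phi> b"
    proof (rule field_le_epsilon)
      fix e :: real assume "0 < e"
      then have "(c (\<phi> a + e / 2) - a) + (c (\<phi> b + e / 2) - b) \<in> N"
        using ab N(1) by (intro semimodule_add above) auto
      moreover have "(c (\<phi> a + e / 2) - a) + (c (\<phi> b + e / 2) - b)
          = c ((\<phi> a + e / 2) + (\<phi> b + e / 2)) - (a + b)"
        by (simp only: c_add) (simp add: algebra_simps)
      ultimately show "\<phi> (a + b) \<le> \<phi> a + \<phi> b + e"
        using upper[OF A_add[OF ab]] by fastforce
    qed
    show "\<phi> a + \<phi> b \<le> \<phi> (a + b)"
    proof (rule field_le_epsilon)
      fix e :: real assume "0 < e"
      then have "(a - c (\<phi> a - e / 2)) + (b - c (\<phi> b - e / 2)) \<in> N"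
        using ab N(1) by (intro semimodule_add below) auto
      moreover have "(a - c (\<phi> a - e / 2)) + (b - c (\<phi> b - e / 2))
          = (a + b) - c ((\<phi> a - e / 2) + (\<phi> b - e / 2))"
        by (simp only: c_add) (simp add: algebra_simps)
      ultimately show "\<phi> a + \<phi> b \<le> \<phi> (a + b) + e"
        using lower[OF A_add[OF ab]] by fastforce
    qed
  qed
  have nonneg: "0 \<le> \<phi> p" if "p \<in> N" for p
    using lower[OF semimodule_A[OF N(1) that], of 0] that by (simp add: c_0)
  have nonneg_mult: "0 \<le> \<phi> (s * a)" if s: "s \<in> S" and a: "a \<in> A" "0 \<le> \<phi> a" for s a
  proof (rule field_le_epsilon)
    fix e :: real assume e: "0 < e"
    obtain k where k: "0 < k" "c k - s \<in> S" using arch_pos[OF S_A[OF s]] .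
    \<comment> \<open>Only the strict bound a > - e/k is available in \<open>N\<close>. Multiplying
      it by \<open>s\<close> costs at most \<open>e\<close>, because k bounds s: s (a + e/k) + (k -
      s) e/k = s a + e.\<close>
    have "- (e / k) < \<phi> a" using less_le_trans[OF _ a(2), of "- (e / k)"] e k by simp
    then have "a - c (- (e / k)) \<in> N" using a by (intro below)
    then have "s * (a - c (- (e / k))) + (c k - s) * c (e / k) \<in> N"
      using s k e N(1) by (intro semimodule_add semimodule_mult semimodule_c) auto
    moreover have "s * (a - c (- (e / k))) + (c k - s) * c (e / k) = s * a - c (- (k * (e / k)))"
      by (simp only: c_minus c_mult) (simp add: algebra_simps)
    ultimately have "s * a - c (- (k * (e / k))) \<in> N" by (simp only:)
    then have "s * a - c (- e) \<in> N" using k by simp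
    then show "0 \<le> \<phi> (s * a) + e" using lower[OF A_mult[OF S_A[OF s] a(1)]] by fastforce
  qed
  have ker: "\<phi> (b * a) = 0" if b: "b \<in> A" and a: "a \<in> A" "\<phi> a = 0" for a b
  proof -
    have S_ker: "\<phi> (s * d) = 0" if s: "s \<in> S" and d: "d \<in> A" "\<phi> d = 0" for s d
    proof -
      have "\<phi> (- d) = 0"
        using add[OF d(1) A_uminus[OF d(1)]] d(2) \<phi>_c[of 0] by (simp add: c_0)
      then have "0 \<le> \<phi> (s * (- d))" using nonneg_mult[OF s A_uminus[OF d(1)]] by simp
      moreover have "0 \<le> \<phi> (s * d)" using nonneg_mult[OF s d(1)] d(2) by simp
      moreover have "\<phi> (s * d) + \<phi> (s * (- d)) = 0"
        using add[of "s * d" "s * (- d)"] s d S_A A_mult A_uminus \<phi>_c[of 0] by (simp add: c_0)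
      ultimately show ?thesis by linarith
    qed
    \<comment> \<open>Again b = k - (k - b) is a difference of elements of \<open>S\<close>, for
      which the claim is \<open>S_ker\<close>; so the kernel is an ideal of
      \<open>A\<close>.\<close>
    obtain k where k: "0 < k" "c k - b \<in> S" using arch_pos[OF b] .
    have "\<phi> (b * a) + \<phi> ((c k - b) * a) = \<phi> (c k * a)"
      using add[OF A_mult[OF b a(1)] A_mult[OF S_A[OF k(2)] a(1)]] by (simp add: algebra_simps)
    then show ?thesis using S_ker[OF k(2) a] S_ker[OF S_c a] k(1) by simp
  qed
  \<comment> \<open>Since a - \<phi> a lies in the kernel, a factor may be replaced by its value.
    Doing this for both factors reduces multiplicativity to constants.\<close>
  have shift: "\<phi> (a * b) = \<phi> (c (\<phi> a) * b)" if ab: "a \<in> A" "b \<in> A" for a b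
  proof -
    have d: "a - c (\<phi> a) \<in> A" using ab(1) A_c by (rule A_diff)
    have b: "c (\<phi> a) * b \<in> A" using A_c ab(2) by (rule A_mult)
    have "\<phi> (a - c (\<phi> a)) = 0"
      using add[OF d A_c[of "\<phi> a"]] \<phi>_c by simp
    then have "\<phi> (b * (a - c (\<phi> a))) = 0" using ker[OF ab(2) d] by blast
    moreover have "\<phi> (b * (a - c (\<phi> a))) + \<phi> (c (\<phi> a) * b) = \<phi> (a * b)"
      using add[OF A_mult[OF ab(2) d] b] by (simp add: algebra_simps)
    ultimately show ?thesis by simp
  qed
  have mult: "\<phi> (a * b) = \<phi> a * \<phi> b" if ab: "a \<in> A" "b \<in> A" for a b
    using shift[OF ab] shift[OF ab(2) A_c, of "\<phi> a"] \<phi>_c[of "\<phi> b * \<phi> a"]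
    by (simp add: c_mult mult.commute)
  show ?thesis
    using that[of \<phi>] add mult \<phi>_c nonneg MN unfolding positive_character_def by blast
qed

section \<open>The abstract Positivstellensatz\<close>

text \<open>If the semimodule generated by \<open>M\<close> and \<open>- f\<close> were proper, it
  would have a character with value at most 0 at \<open>f\<close>. Hence it contains
  \<open>- 1\<close>, which gives s f = 1 + p, a certificate with denominator \<open>s\<close>. The
  denominator is removed by lowering, step by step, a constant \<open>r\<close> with
  \<open>f + c r\<close> in \<open>M\<close>.\<close>

theorem archimedean_positivstellensatz:
  assumes M: "semimodule M" and f: "f \<in> A"
    and pos: "\<And>\<phi>. positive_character M \<phi> \<Longrightarrow> 0 < \<phi> f"
  shows "f \<in> M"
proof -
  let ?N = "{p + (- f) * s | p s. p \<in> M \<and> s \<in> S}"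
  have N: "semimodule ?N" using semimodule_adjoin[OF M A_uminus[OF f]] .
  have "- 1 \<in> ?N"
  proof (rule ccontr)
    assume "- 1 \<notin> ?N"
    then obtain \<phi> where \<phi>: "positive_character ?N \<phi>" using positive_character_exists[OF N] by blast
    have "p \<in> ?N" if "p \<in> M" for p
    proof -
      have "p = p + (- f) * c 0" by (simp add: c_0)
      then show ?thesis using that S_c[of 0] by blast
    qed
    then have "0 < \<phi> f" using \<phi> by (intro pos) (auto simp: positive_character_def)
    moreover have "- f \<in> ?N"
    proof -
      have "- f = 0 + (- f) * 1" by simp
      moreover have "0 \<in> M" "1 \<in> S" using semimodule_c[OF M, of 0] S_c[of 1] by (simp_all add: c_0 c_1)
      ultimately show ?thesis by blast
    qed
    then have "0 \<le> \<phi> (- f)" using \<phi> unfolding positive_character_def by blast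
    moreover have "\<phi> (f + - f) = \<phi> f + \<phi> (- f)" "\<phi> (c 0) = 0"
      using \<phi> f A_uminus unfolding positive_character_def by blast+
    then have "\<phi> f + \<phi> (- f) = 0" by (simp add: c_0)
    ultimately show False by linarith
  qed
  then obtain p s where ps: "- 1 = p + (- f) * s" "p \<in> M" "s \<in> S" by blast
  then have sf: "s * f = 1 + p" by (simp add: algebra_simps)
  obtain k where k: "0 < k" "c k - s \<in> S" using arch_pos[OF S_A[OF ps(3)]] .
  \<comment> \<open>\<open>k (f + r) - 1 = (k - s) (f + r) + p + r s\<close>\<close>
  have step: "f + c (r - 1 / k) \<in> M" if r: "0 \<le> r" "f + c r \<in> M" for r
  proof -
    have "(c k - s) * (f + c r) \<in> M" "c r * s \<in> M"
      using k r ps(3) M S_c semimodule_S semimodule_mult by blast+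
    then have "c (1 / k) * ((c k - s) * (f + c r) + p + c r * s) \<in> M"
      using k ps(2) semimodule_add[OF M] semimodule_mult[OF M] S_c[of "1 / k"] by simp
    moreover have "(c k - s) * (f + c r) + p + c r * s = c k * (f + c r) - 1"
      using sf by (simp add: algebra_simps)
    then have "c (1 / k) * ((c k - s) * (f + c r) + p + c r * s) = c (1 / k * k) * (f + c r) - c (1 / k)"
      by (simp only: c_mult) (simp add: algebra_simps)
    then have "c (1 / k) * ((c k - s) * (f + c r) + p + c r * s) = f + c (r - 1 / k)"
      using k(1) by (simp add: c_1 c_diff)
    ultimately show ?thesis by (simp only:)
  qed
  obtain r0 where r0: "0 < r0" "c r0 - (- f) \<in> S" using arch_pos[OF A_uminus[OF f]] .
  have up: "f + c r' \<in> M" if "f + c r \<in> M" "r \<le> r'" for r r'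
  proof -
    have "(f + c r) + c (r' - r) \<in> M" using that M by (intro semimodule_add[OF M that(1)] semimodule_c) auto
    then show ?thesis by (simp add: c_diff)
  qed
  \<comment> \<open>Each round lowers the constant by 1/k. It is truncated at 0 because
    \<open>step\<close> needs a nonnegative constant, and once 0 is reached \<open>f\<close> itself
    lies in \<open>M\<close>.\<close>
  have iter: "f + c (max 0 (r0 - real n / k)) \<in> M" for n
  proof (induction n)
    case 0
    then show ?case using r0 semimodule_S[OF M] by (simp add: add.commute)
  next
    case (Suc n)
    show ?case
    proof (cases "0 \<le> r0 - real n / k")
      case True
      then have "f + c (r0 - real n / k - 1 / k) \<in> M" using step Suc by simp
      then show ?thesis by (rule up) (simp add: add_divide_distrib)
    next
      case False
      then have "f + c 0 \<in> M" using Suc by simp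
      then show ?thesis by (rule up) simp
    qed
  qed
  obtain n :: nat where "r0 * k < real n" using reals_Archimedean2 by blast
  then have "max 0 (r0 - real n / k) = 0" using k by (simp add: field_simps)
  then show ?thesis using iter[of n] by (simp add: c_0)
qed

end

section \<open>Hermitian polynomials\<close>

text \<open>The complex linear span of the family \<open>b\<close>, with an arbitrary finite
  support. Holomorphic and mixed polynomials are both instances, so their closure properties are
  proved once.\<close>

definition lincomb :: "('i \<Rightarrow> 'x \<Rightarrow> complex) \<Rightarrow> ('x \<Rightarrow> complex) set" where
  "lincomb b = {\<psi>. \<exists>F c. finite F \<and> \<psi> = (\<lambda>x. \<Sum>i\<in>F. c i * b i x)}"

lemma lincomb_base: "b i \<in> lincomb b"
  unfolding lincomb_def by (rule CollectI, rule exI[of _ "{i}"], rule exI[of _ "\<lambda>_. 1"]) simp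

lemma lincomb_scale:
  assumes "\<psi> \<in> lincomb b"
  shows "(\<lambda>x. k * \<psi> x) \<in> lincomb b"
proof -
  obtain F c where "finite F" "\<psi> = (\<lambda>x. \<Sum>i\<in>F. c i * b i x)"
    using assms unfolding lincomb_def by blast
  then show ?thesis unfolding lincomb_def
    by (intro CollectI exI[of _ F] exI[of _ "\<lambda>i. k * c i"]) (simp add: sum_distrib_left mult.assoc)
qed

lemma lincomb_add:
  assumes "\<psi> \<in> lincomb b" "\<xi> \<in> lincomb b"
  shows "(\<lambda>x. \<psi> x + \<xi> x) \<in> lincomb b"
proof -
  obtain F c where F: "finite F" "\<psi> = (\<lambda>x. \<Sum>i\<in>F. c i * b i x)"
    using assms(1) unfolding lincomb_def by blast
  obtain G d where G: "finite G" "\<xi> = (\<lambda>x. \<Sum>i\<in>G. d i * b i x)"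
    using assms(2) unfolding lincomb_def by blast
  have "\<psi> x = (\<Sum>i\<in>F \<union> G. (if i \<in> F then c i else 0) * b i x)" for x
    unfolding F(2) by (rule sum.mono_neutral_cong_left) (use F(1) G(1) in auto)
  moreover have "\<xi> x = (\<Sum>i\<in>F \<union> G. (if i \<in> G then d i else 0) * b i x)" for x
    unfolding G(2) by (rule sum.mono_neutral_cong_left) (use F(1) G(1) in auto)
  ultimately have "(\<lambda>x. \<psi> x + \<xi> x) = (\<lambda>x. \<Sum>i\<in>F \<union> G.
      ((if i \<in> F then c i else 0) + (if i \<in> G then d i else 0)) * b i x)"
    by (simp add: sum.distrib distrib_right)
  then show ?thesis unfolding lincomb_def using F(1) G(1)
    by (intro CollectI exI[of _ "F \<union> G"] exI conjI) auto
qed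

lemma lincomb_induct [consumes 1, case_names zero scale add]:
  assumes "\<psi> \<in> lincomb b"
    and zero: "P (\<lambda>_. 0)"
    and scale: "\<And>k i. P (\<lambda>x. k * b i x)"
    and add: "\<And>\<psi> \<xi>. P \<psi> \<Longrightarrow> P \<xi> \<Longrightarrow> P (\<lambda>x. \<psi> x + \<xi> x)"
  shows "P \<psi>"
proof -
  obtain F c where F: "finite F" "\<psi> = (\<lambda>x. \<Sum>i\<in>F. c i * b i x)"
    using assms(1) unfolding lincomb_def by blast
  from F(1) have "P (\<lambda>x. \<Sum>i\<in>F. c i * b i x)"
    by (induction F rule: finite_induct) (simp_all add: zero add scale)
  then show ?thesis unfolding F(2) .
qed

lemma lincomb_0: "(\<lambda>_. 0) \<in> lincomb b"
  unfolding lincomb_def by (rule CollectI, rule exI[of _ "{}"]) simp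

lemma lincomb_mult:
  assumes "\<psi> \<in> lincomb b" "\<xi> \<in> lincomb b"
    and closed: "\<And>i j. (\<lambda>x. b i x * b j x) \<in> lincomb b"
  shows "(\<lambda>x. \<psi> x * \<xi> x) \<in> lincomb b"
  using assms(1)
proof (induction rule: lincomb_induct)
  case zero
  then show ?case by (simp add: lincomb_0)
next
  case (scale k i)
  from assms(2) have "(\<lambda>x. b i x * \<xi> x) \<in> lincomb b"
  proof (induction rule: lincomb_induct)
    case zero
    then show ?case by (simp add: lincomb_0)
  next
    case (scale k j)
    then show ?case using lincomb_scale[OF closed[of i j], of k] by (simp add: mult.left_commute)
  next
    case (add \<psi> \<xi>)
    then show ?case using lincomb_add by (simp add: distrib_left)
  qed
  then show ?case using lincomb_scale by (simp add: mult.assoc)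
next
  case (add \<psi> \<xi>)
  then show ?case using lincomb_add by (simp add: distrib_right)
qed

text \<open>Padding coefficients by zero passes from an arbitrary finite support to one of the sets
  \<open>B l\<close>. This connects spans with the degree-bounded sums that define the
  polynomials.\<close>

lemma lincomb_eq_bounded:
  fixes b :: "'i \<Rightarrow> 'x \<Rightarrow> complex" and B :: "nat \<Rightarrow> 'i set"
  assumes "\<And>l. finite (B l)" "\<And>F. finite F \<Longrightarrow> \<exists>l. F \<subseteq> B l"
  shows "\<psi> \<in> lincomb b \<longleftrightarrow> (\<exists>l c. \<forall>x. \<psi> x = (\<Sum>i\<in>B l. c i * b i x))"
proof
  assume "\<psi> \<in> lincomb b"
  then obtain F c where F: "finite F" "\<psi> = (\<lambda>x. \<Sum>i\<in>F. c i * b i x)"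
    unfolding lincomb_def by blast
  obtain l where l: "F \<subseteq> B l" using assms(2)[OF F(1)] by blast
  have "\<psi> x = (\<Sum>i\<in>B l. (if i \<in> F then c i else 0) * b i x)" for x
    unfolding F(2) by (rule sum.mono_neutral_cong_left) (use l assms(1) in auto)
  then show "\<exists>l c. \<forall>x. \<psi> x = (\<Sum>i\<in>B l. c i * b i x)"
    by (intro exI[of _ l] exI[of _ "\<lambda>i. if i \<in> F then c i else 0"] allI)
next
  assume "\<exists>l c. \<forall>x. \<psi> x = (\<Sum>i\<in>B l. c i * b i x)"
  then obtain l c where "\<psi> = (\<lambda>x. \<Sum>i\<in>B l. c i * b i x)" by blast
  then show "\<psi> \<in> lincomb b" unfolding lincomb_def using assms(1)
    by (intro CollectI exI[of _ "B l"] exI[of _ c]) simp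
qed

section \<open>Holomorphic and mixed polynomials\<close>

definition mixed_monomial ::
  "('n \<Rightarrow> nat) \<times> ('n \<Rightarrow> nat) \<Rightarrow> complex ^ 'n::finite \<Rightarrow> complex" where
  "mixed_monomial = (\<lambda>(\<alpha>, \<beta>) z. cnj (mpow z \<alpha>) * mpow z \<beta>)"

definition cpoly :: "(complex ^ 'n::finite \<Rightarrow> complex) set" where
  "cpoly = lincomb mixed_monomial"

lemma mpow_add: "mpow z (\<lambda>i. \<alpha> i + \<beta> i) = mpow z \<alpha> * mpow z \<beta>"
  unfolding mpow_def by (simp add: power_add prod.distrib)

lemma mpow_zero: "mpow z (\<lambda>_. 0) = 1"
  unfolding mpow_def by simp

lemma mpow_single: "mpow z (\<lambda>j. if j = i then 1 else 0) = z $ i"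
  unfolding mpow_def by (simp add: if_distrib[where f="\<lambda>k. _ ^ k"] cong: if_cong)

lemma finite_subset_mdeg_le:
  assumes "finite F"
  shows "\<exists>l. F \<subseteq> {\<alpha>. mdeg \<alpha> \<le> l}"
  using finite_imageI[OF assms, of mdeg] by (auto simp: finite_nat_set_iff_bounded_le)

lemma hol_poly_eq: "hol_poly = lincomb (\<lambda>\<alpha> z. mpow z \<alpha>)"
  unfolding hol_poly_def
  by (intro set_eqI) (simp add: lincomb_eq_bounded[OF finite_mdeg_le finite_subset_mdeg_le])

text \<open>The double sum is a single sum over a square box of exponent pairs, and every finite set
  of pairs fits into such a box, with the larger of the two degree bounds as its size.\<close>

lemma real_cpoly_iff: "\<phi> \<in> real_cpoly \<longleftrightarrow> (\<lambda>z. complex_of_real (\<phi> z)) \<in> cpoly"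
proof -
  let ?B = "\<lambda>l. {\<alpha> :: 'a \<Rightarrow> nat. mdeg \<alpha> \<le> l} \<times> {\<alpha> :: 'a \<Rightarrow> nat. mdeg \<alpha> \<le> l}"
  have fin: "finite (?B l)" for l using finite_mdeg_le by blast
  have sub: "\<exists>l. F \<subseteq> ?B l" if F: "finite F" for F
  proof -
    obtain l k where "fst ` F \<subseteq> {\<alpha>. mdeg \<alpha> \<le> l}" "snd ` F \<subseteq> {\<alpha>. mdeg \<alpha> \<le> k}"
      using finite_subset_mdeg_le[OF finite_imageI[OF F, of fst]]
        finite_subset_mdeg_le[OF finite_imageI[OF F, of snd]] by blast
    then have "F \<subseteq> ?B (max l k)" by (fastforce simp: image_subset_iff)
    then show ?thesis ..
  qed
  have split: "(\<Sum>\<alpha> | mdeg \<alpha> \<le> l. \<Sum>\<beta> | mdeg \<beta> \<le> l. d \<alpha> \<beta> * cnj (mpow z \<alpha>) * mpow z \<beta>)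
      = (\<Sum>i\<in>?B l. case_prod d i * mixed_monomial i z)" for d l and z :: "complex ^ 'a"
    by (simp add: sum.cartesian_product mixed_monomial_def case_prod_beta mult.assoc)
  have curry: "(\<exists>c. P c) \<longleftrightarrow> (\<exists>d. P (case_prod d))" for P :: "(('a \<Rightarrow> nat) \<times> ('a \<Rightarrow> nat) \<Rightarrow> complex) \<Rightarrow> bool"
    by (metis case_prod_curry)
  show ?thesis
    unfolding real_cpoly_def cpoly_def mem_Collect_eq split
    by (subst lincomb_eq_bounded[of ?B, OF fin sub], assumption, subst curry, rule refl)
qed

lemma mixed_monomial_mult:
  "mixed_monomial (\<alpha>, \<beta>) z * mixed_monomial (\<gamma>, \<delta>) z
    = mixed_monomial ((\<lambda>i. \<alpha> i + \<gamma> i), (\<lambda>i. \<beta> i + \<delta> i)) z"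
  unfolding mixed_monomial_def by (simp add: mpow_add)

lemma hol_poly_add: "p \<in> hol_poly \<Longrightarrow> q \<in> hol_poly \<Longrightarrow> (\<lambda>z. p z + q z) \<in> hol_poly"
  unfolding hol_poly_eq by (rule lincomb_add)

lemma hol_poly_scale: "p \<in> hol_poly \<Longrightarrow> (\<lambda>z. k * p z) \<in> hol_poly"
  unfolding hol_poly_eq by (rule lincomb_scale)

lemma hol_poly_mpow: "(\<lambda>z. mpow z \<alpha>) \<in> hol_poly"
  unfolding hol_poly_eq by (rule lincomb_base)

lemma hol_poly_mult: "p \<in> hol_poly \<Longrightarrow> q \<in> hol_poly \<Longrightarrow> (\<lambda>z. p z * q z) \<in> hol_poly"
  unfolding hol_poly_eq
  by (erule (1) lincomb_mult) (simp add: mpow_add[symmetric] lincomb_base[of "\<lambda>\<alpha> z. mpow z \<alpha>"])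

lemma hol_poly_const: "(\<lambda>_. k) \<in> hol_poly"
  using hol_poly_scale[OF hol_poly_mpow[of "\<lambda>_. 0"], of k] by (simp add: mpow_zero)

lemma cpoly_add: "p \<in> cpoly \<Longrightarrow> q \<in> cpoly \<Longrightarrow> (\<lambda>z. p z + q z) \<in> cpoly"
  unfolding cpoly_def by (rule lincomb_add)

lemma cpoly_scale: "p \<in> cpoly \<Longrightarrow> (\<lambda>z. k * p z) \<in> cpoly"
  unfolding cpoly_def by (rule lincomb_scale)

lemma cpoly_mult: "p \<in> cpoly \<Longrightarrow> q \<in> cpoly \<Longrightarrow> (\<lambda>z. p z * q z) \<in> cpoly"
  unfolding cpoly_def
  by (erule (1) lincomb_mult) (auto simp: mixed_monomial_mult intro: lincomb_base)

lemma hol_poly_imp_cpoly: "p \<in> hol_poly \<Longrightarrow> p \<in> cpoly"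
  unfolding hol_poly_eq
proof (induction rule: lincomb_induct)
  case zero
  show ?case unfolding cpoly_def by (rule lincomb_0)
next
  case (scale k \<alpha>)
  have "(\<lambda>z. k * mixed_monomial (\<lambda>_. 0, \<alpha>) z) \<in> cpoly"
    unfolding cpoly_def by (intro lincomb_scale lincomb_base)
  then show ?case by (simp add: mixed_monomial_def mpow_zero)
qed (rule cpoly_add)

lemma cpoly_cnj: "p \<in> cpoly \<Longrightarrow> (\<lambda>z. cnj (p z)) \<in> cpoly"
  unfolding cpoly_def
proof (induction rule: lincomb_induct)
  case zero
  show ?case by (simp add: lincomb_0)
next
  case (scale k i)
  obtain \<alpha> \<beta> where i: "i = (\<alpha>, \<beta>)" by fastforce
  have "(\<lambda>z. cnj k * mixed_monomial (\<beta>, \<alpha>) z) \<in> lincomb mixed_monomial"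
    by (intro lincomb_scale lincomb_base)
  then show ?case unfolding i by (simp add: mixed_monomial_def mult.commute)
next
  case (add p q)
  then show ?case using lincomb_add by simp
qed

lemma cpoly_const: "(\<lambda>_. k) \<in> cpoly"
  by (intro hol_poly_imp_cpoly hol_poly_const)

text \<open>Mixed polynomials are closed under conjugation, and the real part is half the sum of
  \<open>p\<close> and its conjugate.\<close>

lemma Re_in_real_cpoly: assumes "p \<in> cpoly" shows "(\<lambda>z. Re (p z)) \<in> real_cpoly"
  unfolding real_cpoly_iff
  using cpoly_scale[OF cpoly_add[OF assms cpoly_cnj[OF assms]], of "1 / 2"]
  by (simp add: complex_add_cnj)

lemma Im_in_real_cpoly: assumes "p \<in> cpoly" shows "(\<lambda>z. Im (p z)) \<in> real_cpoly"
  using Re_in_real_cpoly[OF cpoly_scale[OF assms, of "- \<i>"]] by simp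

lemma real_cpoly_add: "p \<in> real_cpoly \<Longrightarrow> q \<in> real_cpoly \<Longrightarrow> (\<lambda>z. p z + q z) \<in> real_cpoly"
  unfolding real_cpoly_iff of_real_add by (rule cpoly_add)

lemma real_cpoly_mult: "p \<in> real_cpoly \<Longrightarrow> q \<in> real_cpoly \<Longrightarrow> (\<lambda>z. p z * q z) \<in> real_cpoly"
  unfolding real_cpoly_iff of_real_mult by (rule cpoly_mult)

lemma real_cpoly_const: "(\<lambda>_. k) \<in> real_cpoly"
  unfolding real_cpoly_iff by (rule cpoly_const)

lemma real_cpoly_sum:
  "(\<And>i. i \<in> I \<Longrightarrow> p i \<in> real_cpoly) \<Longrightarrow> (\<lambda>z. \<Sum>i\<in>I. p i z) \<in> real_cpoly"
  by (induction I rule: infinite_finite_induct) (simp_all add: real_cpoly_const real_cpoly_add)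

lemma norm_square_in_real_cpoly:
  assumes "p \<in> hol_poly"
  shows "(\<lambda>z. (cmod (p z))\<^sup>2) \<in> real_cpoly"
  unfolding real_cpoly_iff complex_norm_square
  by (intro cpoly_mult cpoly_cnj hol_poly_imp_cpoly assms)

section \<open>Sums of Hermitian squares\<close>

lemma herm_sos_square: "p \<in> hol_poly \<Longrightarrow> (\<lambda>z. (cmod (p z))\<^sup>2) \<in> herm_sos"
  unfolding herm_sos_def by (rule CollectI, rule exI[of _ 1], rule exI[of _ "\<lambda>_. p"]) simp

lemma herm_sos_add:
  assumes "\<sigma> \<in> herm_sos" "\<tau> \<in> herm_sos"
  shows "(\<lambda>z. \<sigma> z + \<tau> z) \<in> herm_sos"
proof -
  obtain r p where r: "1 \<le> r" "\<forall>j\<in>{1..r}. p j \<in> hol_poly" "\<forall>z. \<sigma> z = (\<Sum>j=1..r::nat. (cmod (p j z))\<^sup>2)"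
    using assms(1) unfolding herm_sos_def by blast
  obtain s q where s: "1 \<le> s" "\<forall>j\<in>{1..s}. q j \<in> hol_poly" "\<forall>z. \<tau> z = (\<Sum>j=1..s::nat. (cmod (q j z))\<^sup>2)"
    using assms(2) unfolding herm_sos_def by blast
  \<comment> \<open>The two families of polynomials are concatenated: indices beyond
    \<open>r\<close> belong to the second family, shifted by \<open>r\<close>.\<close>
  let ?w = "\<lambda>j. if j \<le> r then p j else q (j - r)"
  have "\<sigma> z + \<tau> z = (\<Sum>j=1..r + s. (cmod (?w j z))\<^sup>2)" for z
  proof -
    have "(\<Sum>j=1..r + s. (cmod (?w j z))\<^sup>2)
        = (\<Sum>j=1..r. (cmod (?w j z))\<^sup>2) + (\<Sum>j=r + 1..r + s. (cmod (?w j z))\<^sup>2)"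
      by (rule sum.ub_add_nat) simp
    also have "(\<Sum>j=1..r. (cmod (?w j z))\<^sup>2) = \<sigma> z"
      using r(3) by (simp cong: sum.cong_simp)
    also have "(\<Sum>j=r + 1..r + s. (cmod (?w j z))\<^sup>2) = \<tau> z"
      using sum.shift_bounds_cl_nat_ivl[of "\<lambda>j. (cmod (?w j z))\<^sup>2" 1 r s] s(3)
      by (simp add: add.commute cong: sum.cong_simp)
    finally show ?thesis ..
  qed
  moreover have "?w j \<in> hol_poly" if "j \<in> {1..r + s}" for j
  proof (cases "j \<le> r")
    case False
    then have "j - r \<in> {1..s}" using that by auto
    then show ?thesis using False s(2) by simp
  qed (use that r(2) in simp)
  ultimately show ?thesis unfolding herm_sos_def using r(1)
    by (intro CollectI exI[of _ "r + s"] exI[of _ ?w]) auto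
qed

lemma herm_sos_induct [consumes 1, case_names square add]:
  assumes "\<sigma> \<in> herm_sos"
    and square: "\<And>p. p \<in> hol_poly \<Longrightarrow> P (\<lambda>z. (cmod (p z))\<^sup>2)"
    and add: "\<And>\<sigma> \<tau>. \<sigma> \<in> herm_sos \<Longrightarrow> \<tau> \<in> herm_sos \<Longrightarrow> P \<sigma> \<Longrightarrow> P \<tau> \<Longrightarrow> P (\<lambda>z. \<sigma> z + \<tau> z)"
  shows "P \<sigma>"
proof -
  obtain r p where r: "1 \<le> r" "\<forall>j\<in>{1..r}. p j \<in> hol_poly" and \<sigma>: "\<sigma> = (\<lambda>z. \<Sum>j=1..r::nat. (cmod (p j z))\<^sup>2)"
    using assms(1) unfolding herm_sos_def by blast
  \<comment> \<open>Membership in \<open>herm_sos\<close> is carried along because the hypothesis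
    \<open>add\<close> demands it. The induction starts at one summand, as empty sums are excluded
    by definition.\<close>
  from r have "(\<lambda>z. \<Sum>j=1..r. (cmod (p j z))\<^sup>2) \<in> herm_sos \<and> P (\<lambda>z. \<Sum>j=1..r. (cmod (p j z))\<^sup>2)"
  proof (induction r rule: dec_induct)
    case base
    then show ?case by (simp add: square herm_sos_square)
  next
    case (step n)
    then show ?case by (simp add: square add herm_sos_square herm_sos_add)
  qed
  then show ?thesis unfolding \<sigma> by blast
qed

lemma herm_sos_const: "0 \<le> k \<Longrightarrow> (\<lambda>_. k) \<in> herm_sos"
  using herm_sos_square[OF hol_poly_const[of "complex_of_real (sqrt k)"]] by simp

lemma herm_sos_sum:
  "(\<And>i. i \<in> I \<Longrightarrow> \<sigma> i \<in> herm_sos) \<Longrightarrow> (\<lambda>z. \<Sum>i\<in>I. \<sigma> i z) \<in> herm_sos"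
  by (induction I rule: infinite_finite_induct) (simp_all add: herm_sos_const herm_sos_add)

lemma herm_sos_mult:
  assumes "\<sigma> \<in> herm_sos" "\<tau> \<in> herm_sos"
  shows "(\<lambda>z. \<sigma> z * \<tau> z) \<in> herm_sos"
  using assms(1)
proof (induction rule: herm_sos_induct)
  case (square p)
  from assms(2) show ?case
  proof (induction rule: herm_sos_induct)
    case (square q)
    with \<open>p \<in> hol_poly\<close> show ?case
      using herm_sos_square[OF hol_poly_mult] by (simp add: norm_mult power_mult_distrib)
  qed (simp add: distrib_left herm_sos_add)
qed (simp add: distrib_right herm_sos_add)

lemma herm_sos_nonneg: "\<sigma> \<in> herm_sos \<Longrightarrow> 0 \<le> \<sigma> z"
  by (induction rule: herm_sos_induct) simp_all

lemma herm_sos_imp_real_cpoly: "\<sigma> \<in> herm_sos \<Longrightarrow> \<sigma> \<in> real_cpoly"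
  by (induction rule: herm_sos_induct) (simp_all add: norm_square_in_real_cpoly real_cpoly_add)

text \<open>Polarization: the real part of cnj u * w equals |(u + w)/2|^2 - |(u - w)/2|^2. With the
  coefficient \<open>k\<close> absorbed into w, this turns each mixed monomial term into a
  difference of two Hermitian squares.\<close>

lemma cpoly_Re_diff_herm_sos:
  "p \<in> cpoly \<Longrightarrow> \<exists>\<sigma>\<in>herm_sos. \<exists>\<tau>\<in>herm_sos. \<forall>z. Re (p z) = \<sigma> z - \<tau> z"
  unfolding cpoly_def
proof (induction rule: lincomb_induct)
  case zero
  show ?case using herm_sos_const[of 0] by (intro bexI[of _ "\<lambda>_. 0"]) auto
next
  case (scale k i)
  obtain \<alpha> \<beta> where i: "i = (\<alpha>, \<beta>)" by fastforce
  let ?u = "\<lambda>s z. (1 / 2) * (mpow z \<alpha> + s * k * mpow z \<beta>)"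
  have polar: "Re (k * (cnj u * v)) = (cmod ((1 / 2) * (u + 1 * k * v)))\<^sup>2 - (cmod ((1 / 2) * (u + (- 1) * k * v)))\<^sup>2"
    for u v :: complex
    unfolding cmod_power2 by (simp add: field_simps power2_eq_square)
  have sos: "(\<lambda>z. (cmod (?u s z))\<^sup>2) \<in> herm_sos" for s
    by (intro herm_sos_square hol_poly_scale hol_poly_add hol_poly_mpow)
  show ?case unfolding i mixed_monomial_def case_prod_conv polar
    by (rule bexI, rule bexI, rule allI, rule refl, rule sos, rule sos)
next
  case (add p q)
  then obtain \<sigma> \<tau> \<sigma>' \<tau>' where *: "\<sigma> \<in> herm_sos" "\<tau> \<in> herm_sos" "\<sigma>' \<in> herm_sos" "\<tau>' \<in> herm_sos"
    "\<forall>z. Re (p z) = \<sigma> z - \<tau> z" "\<forall>z. Re (q z) = \<sigma>' z - \<tau>' z" by blast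
  show ?case
    by (rule bexI[of _ "\<lambda>z. \<sigma> z + \<sigma>' z"], rule bexI[of _ "\<lambda>z. \<tau> z + \<tau>' z"])
      (use * in \<open>auto intro: herm_sos_add\<close>)
qed

lemma real_cpoly_diff_herm_sos:
  assumes "\<phi> \<in> real_cpoly"
  obtains \<sigma> \<tau> where "\<sigma> \<in> herm_sos" "\<tau> \<in> herm_sos" "\<phi> = (\<lambda>z. \<sigma> z - \<tau> z)"
  using cpoly_Re_diff_herm_sos[OF assms[unfolded real_cpoly_iff]] by (auto simp: fun_eq_iff)

section \<open>Generation by coordinates, and characters as point evaluations\<close>

lemma mpow_closed:
  assumes one: "P (\<lambda>_. 1)" and coord: "\<And>i. P (\<lambda>z. z $ i)"
    and mult: "\<And>p q. P p \<Longrightarrow> P q \<Longrightarrow> P (\<lambda>z. p z * q z)"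
  shows "P (\<lambda>z :: complex ^ 'n::finite. mpow z \<alpha>)"
proof -
  have pow: "P (\<lambda>z. (z $ i) ^ k)" for i and k :: nat
    by (induction k) (simp_all add: one coord mult)
  have "P (\<lambda>z. \<Prod>i\<in>I. (z $ i) ^ \<alpha> i)" for I
    using finite[of I] by (induction I rule: finite_induct) (simp_all add: one pow mult)
  then show ?thesis unfolding mpow_def .
qed

lemma hol_poly_induct [consumes 1, case_names const coord add mult]:
  fixes p :: "complex ^ 'n::finite \<Rightarrow> complex"
  assumes "p \<in> hol_poly"
    and const: "\<And>k. P (\<lambda>_. k)" and coord: "\<And>i. P (\<lambda>z. z $ i)"
    and add: "\<And>p q. P p \<Longrightarrow> P q \<Longrightarrow> P (\<lambda>z. p z + q z)"
    and mult: "\<And>p q. P p \<Longrightarrow> P q \<Longrightarrow> P (\<lambda>z. p z * q z)"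
  shows "P p"
  using assms(1) unfolding hol_poly_eq
proof (induction rule: lincomb_induct)
  case (scale k \<alpha>)
  show ?case by (intro mult const mpow_closed[of P] coord)
qed (simp_all add: const add)

lemma cpoly_induct [consumes 1, case_names const coord cnj add mult]:
  fixes p :: "complex ^ 'n::finite \<Rightarrow> complex"
  assumes "p \<in> cpoly"
    and const: "\<And>k. P (\<lambda>_. k)" and coord: "\<And>i. P (\<lambda>z. z $ i)"
    and cnj: "\<And>p. P p \<Longrightarrow> P (\<lambda>z. cnj (p z))"
    and add: "\<And>p q. P p \<Longrightarrow> P q \<Longrightarrow> P (\<lambda>z. p z + q z)"
    and mult: "\<And>p q. P p \<Longrightarrow> P q \<Longrightarrow> P (\<lambda>z. p z * q z)"
  shows "P p"
  using assms(1) unfolding cpoly_def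
proof (induction rule: lincomb_induct)
  case (scale k i)
  obtain \<alpha> \<beta> where i: "i = (\<alpha>, \<beta>)" by fastforce
  have mono: "P (\<lambda>z. mpow z \<gamma>)" for \<gamma> by (intro mpow_closed[of P] const coord mult)
  show ?case unfolding i mixed_monomial_def case_prod_conv by (intro mult const cnj mono)
qed (simp_all add: const add)

lemma hol_poly_coord: "(\<lambda>z. z $ i) \<in> hol_poly"
  using hol_poly_mpow[of "\<lambda>j. if j = i then 1 else 0"] unfolding mpow_single .

text \<open>Applying \<open>\<phi>\<close> to real and imaginary parts extends it to a complex
  algebra homomorphism on \<open>cpoly\<close> that commutes with conjugation. Such a map is
  determined by its values on the coordinates, and these values are the components of
  \<open>w\<close>.\<close>

lemma real_cpoly_character_eval:
  fixes \<phi> :: "(complex ^ 'n::finite \<Rightarrow> real) \<Rightarrow> real"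
  assumes add: "\<And>p q. p \<in> real_cpoly \<Longrightarrow> q \<in> real_cpoly \<Longrightarrow> \<phi> (\<lambda>z. p z + q z) = \<phi> p + \<phi> q"
    and mult: "\<And>p q. p \<in> real_cpoly \<Longrightarrow> q \<in> real_cpoly \<Longrightarrow> \<phi> (\<lambda>z. p z * q z) = \<phi> p * \<phi> q"
    and const: "\<And>k. \<phi> (\<lambda>_. k) = k"
  obtains w where "\<And>p. p \<in> real_cpoly \<Longrightarrow> \<phi> p = p w"
proof -
  let ?E = "\<lambda>p. Complex (\<phi> (\<lambda>z. Re (p z))) (\<phi> (\<lambda>z. Im (p z)))"
  define w where "w = (\<chi> i. ?E (\<lambda>z. z $ i))"
  have neg: "\<phi> (\<lambda>z. - p z) = - \<phi> p" if "p \<in> real_cpoly" for p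
    using mult[OF real_cpoly_const[of "- 1"] that] const by simp
  have diff: "\<phi> (\<lambda>z. p z - q z) = \<phi> p - \<phi> q" if "p \<in> real_cpoly" "q \<in> real_cpoly" for p q
    using add[OF that(1) real_cpoly_mult[OF real_cpoly_const[of "- 1"] that(2)]] neg[OF that(2)] by simp
  \<comment> \<open>Membership in \<open>cpoly\<close> is part of the induction claim because
    \<open>\<phi>\<close> is additive and multiplicative only on \<open>real_cpoly\<close>.\<close>
  have E: "p \<in> cpoly \<and> ?E p = p w" if "p \<in> cpoly" for p
    using that
  proof (induction rule: cpoly_induct)
    case (const k)
    show ?case by (simp add: cpoly_const assms(3) complex_eq_iff)
  next
    case (coord i)
    show ?case by (simp add: hol_poly_imp_cpoly hol_poly_coord w_def)
  next
    case (cnj p)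
    then show ?case by (auto simp: cpoly_cnj neg Im_in_real_cpoly complex_eq_iff)
  next
    case (add p q)
    then show ?case
      by (auto simp: cpoly_add assms(1) Re_in_real_cpoly Im_in_real_cpoly complex_eq_iff)
  next
    case (mult p q)
    then have "p \<in> cpoly" "q \<in> cpoly" "?E p = p w" "?E q = q w" by auto
    note R = this(1,2)[THEN Re_in_real_cpoly] this(1,2)[THEN Im_in_real_cpoly]
    have "?E (\<lambda>z. p z * q z) = ?E p * ?E q"
      by (simp add: R diff assms(1,2) real_cpoly_mult complex_eq_iff)
    then show ?case using mult by (simp add: cpoly_mult)
  qed
  show ?thesis
  proof (rule that[of w])
    fix p :: "complex ^ 'n \<Rightarrow> real" assume "p \<in> real_cpoly"
    then have "?E (\<lambda>z. complex_of_real (p z)) = complex_of_real (p w)"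
      using E unfolding real_cpoly_iff by blast
    then show "\<phi> p = p w" by (simp add: complex_eq_iff)
  qed
qed

section \<open>From a bound on the coordinates to the Archimedean property\<close>

text \<open>The holomorphic polynomials whose squared modulus is bounded modulo \<open>S\<close>
  contain the constants and coordinates and are closed under sums and products, so all are bounded.
  Sums of Hermitian squares are then bounded too, and in \<phi> = \<sigma> - \<tau> a bound for
  \<sigma> suffices.\<close>

lemma real_cpoly_archimedean:
  fixes S :: "(complex ^ 'n::finite \<Rightarrow> real) set"
  assumes sos: "\<And>\<sigma>. \<sigma> \<in> herm_sos \<Longrightarrow> \<sigma> \<in> S"
    and add: "\<And>s t. s \<in> S \<Longrightarrow> t \<in> S \<Longrightarrow> (\<lambda>z. s z + t z) \<in> S"
    and mult: "\<And>s t. s \<in> S \<Longrightarrow> t \<in> S \<Longrightarrow> (\<lambda>z. s z * t z) \<in> S"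
    and ball: "(\<lambda>z. N - (\<Sum>i\<in>UNIV. (cmod (z $ i))\<^sup>2)) \<in> S"
    and \<phi>: "\<phi> \<in> real_cpoly"
  shows "\<exists>k. (\<lambda>z. k - \<phi> z) \<in> S"
proof -
  have mono: "(\<lambda>z. k' - \<psi> z) \<in> S" if "(\<lambda>z. k - \<psi> z) \<in> S" "k \<le> k'" for k k' \<psi>
    using add[OF sos[OF herm_sos_const[of "k' - k"]] that(1)] that(2) by simp
  have hol: "p \<in> hol_poly \<and> (\<exists>k\<ge>0. (\<lambda>z. k - (cmod (p z))\<^sup>2) \<in> S)" if "p \<in> hol_poly" for p
    using that
  proof (induction rule: hol_poly_induct)
    case (const k)
    have "(\<lambda>_. (cmod k)\<^sup>2 - (cmod k)\<^sup>2) \<in> S" using sos[OF herm_sos_const[of 0]] by simp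
    then show ?case using hol_poly_const by (intro conjI exI[of _ "(cmod k)\<^sup>2"]) auto
  next
    case (coord i)
    \<comment> \<open>Adding back the squares of the other coordinates isolates one of them.\<close>
    have "(\<lambda>z. N - (\<Sum>i\<in>UNIV. (cmod (z $ i))\<^sup>2) + (\<Sum>j\<in>UNIV - {i}. (cmod (z $ j))\<^sup>2)) \<in> S"
      by (intro add ball sos herm_sos_sum herm_sos_square hol_poly_coord)
    moreover have "N - (\<Sum>i\<in>UNIV. (cmod (z $ i))\<^sup>2) + (\<Sum>j\<in>UNIV - {i}. (cmod (z $ j))\<^sup>2)
        = N - (cmod (z $ i))\<^sup>2" for z :: "complex ^ 'n"
      by (simp add: sum.remove[of UNIV i])
    ultimately have "(\<lambda>z. N - (cmod (z $ i))\<^sup>2) \<in> S" by simp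
    \<comment> \<open>The bound is made nonnegative because the product case uses it as a multiplier
      from \<open>herm_sos\<close>.\<close>
    then have "(\<lambda>z. max N 0 - (cmod (z $ i))\<^sup>2) \<in> S" by (rule mono) simp
    then show ?case using hol_poly_coord by (intro conjI exI[of _ "max N 0"]) auto
  next
    case (add p q)
    then obtain k l where *: "0 \<le> k" "0 \<le> l" "(\<lambda>z. k - (cmod (p z))\<^sup>2) \<in> S" "(\<lambda>z. l - (cmod (q z))\<^sup>2) \<in> S"
      and pq: "p \<in> hol_poly" "q \<in> hol_poly" by blast
    \<comment> \<open>The parallelogram law: |p + q|^2 + |p - q|^2 = 2 |p|^2 + 2 |q|^2, so 2 k + 2 l
      is a bound for the sum.\<close>
    have "(\<lambda>z. (cmod (p z + (- 1) * q z))\<^sup>2) \<in> S"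
      using pq by (intro sos herm_sos_square hol_poly_add hol_poly_scale)
    with * have "(\<lambda>z. 2 * (k - (cmod (p z))\<^sup>2) + 2 * (l - (cmod (q z))\<^sup>2) + (cmod (p z + (- 1) * q z))\<^sup>2) \<in> S"
      by (intro assms(2) mult sos[OF herm_sos_const]) auto
    moreover have "2 * (k - (cmod u)\<^sup>2) + 2 * (l - (cmod v)\<^sup>2) + (cmod (u + (- 1) * v))\<^sup>2
        = (2 * k + 2 * l) - (cmod (u + v))\<^sup>2" for u v
      unfolding cmod_power2 by (simp add: algebra_simps power2_eq_square)
    ultimately have "(\<lambda>z. (2 * k + 2 * l) - (cmod (p z + q z))\<^sup>2) \<in> S" by (simp only:)
    then show ?case using pq *(1,2) by (intro conjI hol_poly_add exI[of _ "2 * k + 2 * l"]) auto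
  next
    case (mult p q)
    then obtain k l where *: "0 \<le> k" "0 \<le> l" "(\<lambda>z. k - (cmod (p z))\<^sup>2) \<in> S" "(\<lambda>z. l - (cmod (q z))\<^sup>2) \<in> S"
      and pq: "p \<in> hol_poly" "q \<in> hol_poly" by blast
    \<comment> \<open>This telescopes to k l - |p q|^2.\<close>
    have "(\<lambda>z. l * (k - (cmod (p z))\<^sup>2) + (cmod (p z))\<^sup>2 * (l - (cmod (q z))\<^sup>2)) \<in> S"
      using * pq by (intro assms(2,3) sos[OF herm_sos_const] sos[OF herm_sos_square])
    then have "(\<lambda>z. k * l - (cmod (p z * q z))\<^sup>2) \<in> S"
      by (simp add: norm_mult power_mult_distrib algebra_simps)
    then show ?case using pq *(1,2) by (intro conjI hol_poly_mult exI[of _ "k * l"]) auto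
  qed
  have herm: "\<exists>k. (\<lambda>z. k - \<sigma> z) \<in> S" if "\<sigma> \<in> herm_sos" for \<sigma>
    using that
  proof (induction rule: herm_sos_induct)
    case (square p)
    then show ?case using hol by blast
  next
    case (add \<sigma> \<tau>)
    then obtain k l where "(\<lambda>z. k - \<sigma> z) \<in> S" "(\<lambda>z. l - \<tau> z) \<in> S" by blast
    then have "(\<lambda>z. (k - \<sigma> z) + (l - \<tau> z)) \<in> S" by (rule assms(2))
    then show ?case by (intro exI[of _ "k + l"]) (simp add: algebra_simps)
  qed
  obtain \<sigma> \<tau> where st: "\<sigma> \<in> herm_sos" "\<tau> \<in> herm_sos" "\<phi> = (\<lambda>z. \<sigma> z - \<tau> z)"
    using real_cpoly_diff_herm_sos[OF \<phi>] .
  obtain k where "(\<lambda>z. k - \<sigma> z) \<in> S" using herm[OF st(1)] by blast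
  then have "(\<lambda>z. (k - \<sigma> z) + \<tau> z) \<in> S" using sos[OF st(2)] by (rule add)
  then show ?thesis unfolding st(3) by (intro exI[of _ k]) (simp add: algebra_simps)
qed

section \<open>The Hermitian Positivstellensatz\<close>

text \<open>The multiplier-free term is not built in: the constant 1 has to occur among the
  generators \<open>G i\<close>.\<close>

definition herm_module :: "'i set \<Rightarrow> ('i \<Rightarrow> complex ^ 'n::finite \<Rightarrow> real) \<Rightarrow> (complex ^ 'n \<Rightarrow> real) set" where
  "herm_module I G = {p. \<exists>\<sigma>. (\<forall>i\<in>I. \<sigma> i \<in> herm_sos) \<and> p = (\<lambda>z. \<Sum>i\<in>I. \<sigma> i z * G i z)}"

lemma herm_module_add:
  assumes "p \<in> herm_module I G" "q \<in> herm_module I G"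
  shows "(\<lambda>z. p z + q z) \<in> herm_module I G"
proof -
  obtain \<sigma> \<tau> where "\<forall>i\<in>I. \<sigma> i \<in> herm_sos" "p = (\<lambda>z. \<Sum>i\<in>I. \<sigma> i z * G i z)"
    "\<forall>i\<in>I. \<tau> i \<in> herm_sos" "q = (\<lambda>z. \<Sum>i\<in>I. \<tau> i z * G i z)"
    using assms unfolding herm_module_def by blast
  then show ?thesis unfolding herm_module_def
    by (intro CollectI exI[of _ "\<lambda>i z. \<sigma> i z + \<tau> i z"])
      (simp add: herm_sos_add distrib_right sum.distrib)
qed

lemma herm_module_mult:
  assumes "\<tau> \<in> herm_sos" "p \<in> herm_module I G"
  shows "(\<lambda>z. \<tau> z * p z) \<in> herm_module I G"
proof -
  obtain \<sigma> where "\<forall>i\<in>I. \<sigma> i \<in> herm_sos" "p = (\<lambda>z. \<Sum>i\<in>I. \<sigma> i z * G i z)"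
    using assms unfolding herm_module_def by blast
  then show ?thesis unfolding herm_module_def
    by (intro CollectI exI[of _ "\<lambda>i z. \<tau> z * \<sigma> i z"])
      (simp add: herm_sos_mult assms(1) sum_distrib_left mult.assoc)
qed

lemma herm_module_generator:
  assumes "finite I" "i \<in> I"
  shows "G i \<in> herm_module I G"
  unfolding herm_module_def using assms
  by (intro CollectI exI[of _ "\<lambda>j _. if j = i then 1 else 0"])
    (auto simp: herm_sos_const if_distrib[where f="\<lambda>x. x * _"] fun_eq_iff cong: if_cong)

lemma herm_module_real_cpoly:
  assumes "\<And>i. i \<in> I \<Longrightarrow> G i \<in> real_cpoly" "p \<in> herm_module I G"
  shows "p \<in> real_cpoly"
proof -
  obtain \<sigma> where \<sigma>: "\<forall>i\<in>I. \<sigma> i \<in> herm_sos" "p = (\<lambda>z. \<Sum>i\<in>I. \<sigma> i z * G i z)"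
    using assms(2) unfolding herm_module_def by blast
  show ?thesis unfolding \<sigma>(2)
    using \<sigma>(1) by (intro real_cpoly_sum real_cpoly_mult herm_sos_imp_real_cpoly assms(1)) auto
qed

text \<open>Although multipliers must be sums of Hermitian squares, writing q = \<sigma> - \<tau>
  lets \<sigma> act on \<open>h\<close> and \<tau> on \<open>- h\<close>.\<close>

lemma herm_module_ideal:
  assumes "finite I" "i \<in> I" "k \<in> I" "G i = h" "G k = (\<lambda>z. - h z)" "q \<in> real_cpoly"
  shows "(\<lambda>z. q z * h z) \<in> herm_module I G"
proof -
  obtain \<sigma> \<tau> where st: "\<sigma> \<in> herm_sos" "\<tau> \<in> herm_sos" "q = (\<lambda>z. \<sigma> z - \<tau> z)"
    using real_cpoly_diff_herm_sos[OF assms(6)] .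
  have "h \<in> herm_module I G" "(\<lambda>z. - h z) \<in> herm_module I G"
    using herm_module_generator[OF assms(1,2), of G] herm_module_generator[OF assms(1,3), of G] assms(4,5) by simp_all
  then have "(\<lambda>z. \<sigma> z * h z + \<tau> z * (- h z)) \<in> herm_module I G"
    using st by (intro herm_module_add herm_module_mult)
  then show ?thesis unfolding st(3) by (simp add: algebra_simps)
qed

theorem hermitian_positivstellensatz:
  fixes f \<sigma> :: "complex ^ 'n::finite \<Rightarrow> real" and G :: "'i \<Rightarrow> complex ^ 'n \<Rightarrow> real"
  assumes I: "finite I" and G: "\<And>i. i \<in> I \<Longrightarrow> G i \<in> real_cpoly"
    and one: "k \<in> I" "G k = (\<lambda>_. 1)"
    and f: "f \<in> real_cpoly"
    and h: "\<And>j. j \<in> J \<Longrightarrow> \<exists>i\<in>I. G i = h j" "\<And>j. j \<in> J \<Longrightarrow> \<exists>i\<in>I. G i = (\<lambda>z. - h j z)"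
    and r: "\<And>j. j \<in> J \<Longrightarrow> r j \<in> real_cpoly"
    and \<sigma>: "\<sigma> \<in> herm_sos"
    and eq: "\<And>z. (\<Sum>j\<in>J. r j z * h j z) = (\<Sum>i\<in>UNIV. (cmod (z $ i))\<^sup>2) + \<sigma> z + a"
    and pos: "\<And>z. (\<And>i. i \<in> I \<Longrightarrow> 0 \<le> G i z) \<Longrightarrow> 0 < f z"
  shows "f \<in> herm_module I G"
proof -
  let ?M = "herm_module I G"
  \<comment> \<open>The stabilizer of the module is a semiring containing the Hermitian squares and the ideal
    generated by the \<open>h j\<close>, which makes it Archimedean.\<close>
  define S where "S = {s \<in> real_cpoly. \<forall>p\<in>?M. (\<lambda>z. s z * p z) \<in> ?M}"
  have M_poly: "p \<in> real_cpoly" if "p \<in> ?M" for p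
    using herm_module_real_cpoly[OF G that] .
  have S_sos: "\<tau> \<in> S" if "\<tau> \<in> herm_sos" for \<tau>
    unfolding S_def using that herm_sos_imp_real_cpoly herm_module_mult by blast
  have S_add: "(\<lambda>z. s z + t z) \<in> S" if "s \<in> S" "t \<in> S" for s t
    using that unfolding S_def by (auto simp: distrib_right intro: real_cpoly_add herm_module_add)
  have S_mult: "(\<lambda>z. s z * t z) \<in> S" if "s \<in> S" "t \<in> S" for s t
    using that unfolding S_def by (auto simp: mult.assoc intro: real_cpoly_mult)
  have S_ideal: "(\<lambda>z. q z * h j z) \<in> S" if "j \<in> J" "q \<in> real_cpoly" for j q
  proof -
    obtain i k where ik: "i \<in> I" "k \<in> I" "G i = h j" "G k = (\<lambda>z. - h j z)" using h \<open>j \<in> J\<close> by blast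
    then have "h j \<in> real_cpoly" using G by metis
    moreover have "(\<lambda>z. q z * h j z * p z) \<in> ?M" if "p \<in> ?M" for p
      using herm_module_ideal[OF I ik real_cpoly_mult[OF \<open>q \<in> real_cpoly\<close> M_poly[OF that]]]
      by (simp add: mult_ac)
    ultimately show ?thesis unfolding S_def using \<open>q \<in> real_cpoly\<close> real_cpoly_mult by blast
  qed
  have "(\<lambda>z. \<Sum>j\<in>J. (- r j z) * h j z) \<in> S"
  proof -
    have "(\<lambda>z. \<Sum>j\<in>J'. (- r j z) * h j z) \<in> S" if "J' \<subseteq> J" for J'
      using that
    proof (induction J' rule: infinite_finite_induct)
      case (insert j J')
      then have "(\<lambda>z. (- r j z) * h j z) \<in> S"
        using S_ideal[of j "\<lambda>z. - r j z"] real_cpoly_mult[OF real_cpoly_const[of "- 1"] r, of j] by simp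
      then have "(\<lambda>z. (- r j z) * h j z + (\<Sum>j\<in>J'. (- r j z) * h j z)) \<in> S"
        using insert by (intro S_add) auto
      then show ?case using insert.hyps by simp
    qed (simp_all add: S_sos herm_sos_const)
    then show ?thesis by blast
  qed
  \<comment> \<open>Solving \<open>eq\<close> for the squared norm exhibits - a - |z|^2 as \<sigma>
    plus an element of the ideal, which is the coordinate bound with constant
    \<open>- a\<close>.\<close>
  then have "(\<lambda>z. \<sigma> z + (\<Sum>j\<in>J. (- r j z) * h j z)) \<in> S" using S_sos[OF \<sigma>] by (intro S_add)
  moreover have "\<sigma> z + (\<Sum>j\<in>J. (- r j z) * h j z) = - a - (\<Sum>i\<in>UNIV. (cmod (z $ i))\<^sup>2)" for z
    using eq[of z] by (simp add: sum_negf)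
  ultimately have ball: "(\<lambda>z. - a - (\<Sum>i\<in>UNIV. (cmod (z $ i))\<^sup>2)) \<in> S" by simp
  have arch: "\<exists>k. (\<lambda>z. k - \<psi> z) \<in> S" if "\<psi> \<in> real_cpoly" for \<psi>
    by (rule real_cpoly_archimedean[OF S_sos S_add S_mult ball that])
  \<comment> \<open>Functions form a commutative ring under pointwise operations, with constant
    functions in the role of \<open>c\<close>.\<close>
  interpret archimedean_semiring "\<lambda>x _. x" real_cpoly S
  proof unfold_locales
    fix \<psi> :: "complex ^ 'n \<Rightarrow> real" assume "\<psi> \<in> real_cpoly"
    then show "\<exists>k. (\<lambda>_. k) - \<psi> \<in> S"
      unfolding fun_diff_def by (rule arch)
  next
    show "x \<in> real_cpoly" if "x \<in> S" for x using that unfolding S_def by blast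
  next
    show "(\<lambda>_. x) \<in> S" if "0 \<le> x" for x using S_sos[OF herm_sos_const[OF that]] .
  qed (unfold plus_fun_def times_fun_def one_fun_def,
      (rule refl real_cpoly_const real_cpoly_add real_cpoly_mult S_add S_mult; assumption?)+)
  have M: "semimodule ?M"
    unfolding semimodule_def
  proof (intro conjI ballI subsetI)
    show "1 \<in> ?M" using herm_module_generator[OF I one(1), of G] by (simp add: one(2) one_fun_def)
  qed (simp_all add: M_poly plus_fun_def times_fun_def herm_module_add S_def)
  show ?thesis
  proof (rule archimedean_positivstellensatz[OF M f])
    fix \<phi> assume \<phi>: "positive_character ?M \<phi>"
    obtain w where w: "\<And>p. p \<in> real_cpoly \<Longrightarrow> \<phi> p = p w"
    proof (rule real_cpoly_character_eval[of \<phi>])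
    qed (use \<phi> in \<open>auto simp: positive_character_def plus_fun_def times_fun_def\<close>)
    \<comment> \<open>Each generator lies in the module, where the character is nonnegative. Hence
      \<open>w\<close> satisfies all constraints and \<open>pos\<close> applies to it.\<close>
    have "0 \<le> G i w" if "i \<in> I" for i
      using \<phi> herm_module_generator[OF I that, of G] w[OF G[OF that]]
      unfolding positive_character_def by force
    then show "0 < \<phi> f" using pos w[OF f] by simp
  qed
qed

section \<open>Wirtinger gradients and optimality\<close>

definition parts :: "complex ^ 'n::finite \<Rightarrow> (real ^ 'n) \<times> (real ^ 'n)" where
  "parts z = (\<chi> i. Re (z $ i), \<chi> i. Im (z $ i))"

lemma of_parts_parts [simp]: "of_parts (parts z) = z"
  by (simp add: of_parts_def parts_def vec_eq_iff)

text \<open>By uniqueness of the Frechet derivative, any derivative \<open>D\<close> at hand may be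
  used, which reduces the calculus rules below to those for real derivatives.\<close>

lemma wirtinger_has_derivative:
  assumes "(\<phi> \<circ> of_parts has_derivative D) (at (parts z))"
  shows "wirtinger \<phi> z =
    (\<chi> i. (1 / 2) * (complex_of_real (D (axis i 1, 0)) - \<i> * complex_of_real (D (0, axis i 1))))"
  unfolding wirtinger_def Let_def parts_def[symmetric] frechet_derivative_at[OF assms, symmetric] ..

lemma real_cpoly_has_derivative:
  assumes "\<phi> \<in> real_cpoly"
  obtains D where "(\<phi> \<circ> of_parts has_derivative D) (at x)"
  using real_cpoly_differentiable[OF assms] unfolding differentiable_def by blast

lemma wirtinger_const: "wirtinger (\<lambda>_. k) z = 0"
  using wirtinger_has_derivative[of "\<lambda>_. k" "\<lambda>_. 0" z] by (simp add: o_def vec_eq_iff)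

lemma wirtinger_add:
  assumes "p \<in> real_cpoly" "q \<in> real_cpoly"
  shows "wirtinger (\<lambda>z. p z + q z) z = wirtinger p z + wirtinger q z"
proof -
  obtain D E where DE: "(p \<circ> of_parts has_derivative D) (at (parts z))"
    "(q \<circ> of_parts has_derivative E) (at (parts z))"
    using assms[THEN real_cpoly_has_derivative] by metis
  have "((\<lambda>z. p z + q z) \<circ> of_parts has_derivative (\<lambda>v. D v + E v)) (at (parts z))"
    using has_derivative_add[OF DE] by (simp add: o_def)
  from wirtinger_has_derivative[OF this] show ?thesis
    by (simp add: DE[THEN wirtinger_has_derivative] vec_eq_iff algebra_simps add_divide_distrib diff_divide_distrib)
qed

lemma wirtinger_mult:
  assumes "p \<in> real_cpoly" "q \<in> real_cpoly"
  shows "wirtinger (\<lambda>z. p z * q z) z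
    = complex_of_real (p z) *s wirtinger q z + complex_of_real (q z) *s wirtinger p z"
proof -
  obtain D E where DE: "(p \<circ> of_parts has_derivative D) (at (parts z))"
    "(q \<circ> of_parts has_derivative E) (at (parts z))"
    using assms[THEN real_cpoly_has_derivative] by metis
  have "((\<lambda>z. p z * q z) \<circ> of_parts has_derivative (\<lambda>v. p z * E v + D v * q z)) (at (parts z))"
    using has_derivative_mult[OF DE] by (simp add: o_def)
  from wirtinger_has_derivative[OF this] show ?thesis
    by (simp add: DE[THEN wirtinger_has_derivative] vec_eq_iff algebra_simps add_divide_distrib diff_divide_distrib)
qed

lemma wirtinger_sum:
  assumes "finite I" "\<And>i. i \<in> I \<Longrightarrow> p i \<in> real_cpoly"
  shows "wirtinger (\<lambda>z. \<Sum>i\<in>I. p i z) z = (\<Sum>i\<in>I. wirtinger (p i) z)"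
  using assms
  by (induction I rule: finite_induct) (simp_all add: wirtinger_const wirtinger_add real_cpoly_sum)

lemma wirtinger_global_min:
  assumes "p \<in> real_cpoly" and min: "\<And>w. p z \<le> p w"
  shows "wirtinger p z = 0"
proof -
  obtain D where D: "(p \<circ> of_parts has_derivative D) (at (parts z))"
    using assms(1) by (rule real_cpoly_has_derivative)
  have "D = (\<lambda>_. 0)"
    by (rule has_derivative_local_min[OF D]) (simp add: min)
  then show ?thesis using wirtinger_has_derivative[OF D] by (simp add: vec_eq_iff)
qed

theorem corollary3p12:
  fixes f \<sigma> :: "complex ^ 'n::finite \<Rightarrow> real"
    and g h r \<sigma>opt :: "nat \<Rightarrow> complex ^ 'n \<Rightarrow> real"
    and m e :: nat
    and K :: "(complex ^ 'n) set"
    and zopt :: "complex ^ 'n"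
    and a lam :: real
  assumes "1 \<le> m" and "1 \<le> e"
    and "f \<in> real_cpoly"
    and "\<forall>i\<in>{1..m}. g i \<in> real_cpoly"
    and "K = {z. \<forall>i\<in>{1..m}. 0 \<le> g i z}"
    and "compact K"
    and "\<forall>j\<in>{1..e}. h j \<in> real_cpoly"
    and "\<forall>j\<in>{1..e}. (\<exists>i\<in>{1..m}. g i = h j) \<and> (\<exists>i\<in>{1..m}. g i = (\<lambda>z. - h j z))"
    and "\<forall>j\<in>{1..e}. r j \<in> real_cpoly"
    and "\<sigma> \<in> herm_sos"
    and "\<forall>z. (\<Sum>j=1..e. r j z * h j z) = (\<Sum>i\<in>UNIV. (cmod (z $ i))\<^sup>2) + \<sigma> z + a"
    and "zopt \<in> K" and "\<forall>z\<in>K. f zopt \<le> f z"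
    and "sos_optimal f m g lam \<sigma>opt"
  shows "wirtinger f zopt = (\<Sum>i=1..m. complex_of_real (\<sigma>opt i zopt) *s wirtinger (g i) zopt)
    \<and> (\<forall>i\<in>{1..m}. 0 \<le> \<sigma>opt i zopt \<and> 0 \<le> g i zopt \<and> \<sigma>opt i zopt * g i zopt = 0)"
proof -
  let ?G = "g(0 := \<lambda>_. 1)"
  have G: "?G i \<in> real_cpoly" if "i \<in> {0..m}" for i
    using assms(4) that by (simp add: real_cpoly_const)
  have K: "z \<in> K" if "\<And>i. i \<in> {0..m} \<Longrightarrow> 0 \<le> ?G i z" for z
    unfolding assms(5) using that by fastforce
  have feas: "sos_feasible f m g lam \<sigma>opt"
    and best: "\<And>lam' \<sigma>'. sos_feasible f m g lam' \<sigma>' \<Longrightarrow> lam' \<le> lam"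
    using assms(14) unfolding sos_optimal_def by auto
  have sos: "\<sigma>opt i \<in> herm_sos" if "i \<in> {0..m}" for i
    using feas that unfolding sos_feasible_def by blast
  have f_eq: "f z = lam + (\<Sum>i=0..m. \<sigma>opt i z * ?G i z)" for z
    using feas unfolding sos_feasible_def by (metis add.commute diff_add_cancel)
  have "f zopt \<le> lam"
  proof (rule field_le_epsilon)
    fix \<epsilon> :: real assume "0 < \<epsilon>"
    \<comment> \<open>At a minimizer f - f zopt vanishes, while the Positivstellensatz asks for
      strict positivity on \<open>K\<close>; hence the shift by \<epsilon>.\<close>
    have "(\<lambda>z. f z + (\<epsilon> - f zopt)) \<in> herm_module {0..m} ?G"
    proof (rule hermitian_positivstellensatz[where k=0 and J="{1..e}" and h=h and r=r and \<sigma>=\<sigma> and a=a])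
      show "0 < f z + (\<epsilon> - f zopt)" if "\<And>i. i \<in> {0..m} \<Longrightarrow> 0 \<le> ?G i z" for z
        using assms(13) K[OF that] \<open>0 < \<epsilon>\<close> by fastforce
    next
      fix j assume "j \<in> {1..e}"
      then obtain i k where "i \<in> {1..m}" "g i = h j" "k \<in> {1..m}" "g k = (\<lambda>z. - h j z)"
        using assms(8) by blast
      then have "?G i = h j" "i \<in> {0..m}" "?G k = (\<lambda>z. - h j z)" "k \<in> {0..m}" by simp_all
      then show "\<exists>i\<in>{0..m}. ?G i = h j" "\<exists>i\<in>{0..m}. ?G i = (\<lambda>z. - h j z)"
        by blast+
    qed (use G assms(3,9-11) in \<open>auto intro: real_cpoly_add real_cpoly_const\<close>)
    then obtain \<tau> where "\<forall>i\<in>{0..m}. \<tau> i \<in> herm_sos"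
      "\<And>z. f z + (\<epsilon> - f zopt) = (\<Sum>i=0..m. \<tau> i z * ?G i z)"
      unfolding herm_module_def by (auto simp: fun_eq_iff)
    then have "sos_feasible f m g (f zopt - \<epsilon>) \<tau>"
      unfolding sos_feasible_def by (simp add: algebra_simps)
    then show "f zopt \<le> lam + \<epsilon>" using best by fastforce
  qed
  moreover have g_nonneg: "0 \<le> ?G i zopt" if "i \<in> {0..m}" for i
    using assms(5,12) that by auto
  then have nonneg: "0 \<le> \<sigma>opt i zopt * ?G i zopt" if "i \<in> {0..m}" for i
    using that herm_sos_nonneg[OF sos] by simp
  \<comment> \<open>The sum equals f zopt - lam, which is at most 0, and its terms are
    nonnegative.\<close>
  ultimately have "(\<Sum>i=0..m. \<sigma>opt i zopt * ?G i zopt) = 0"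
    using f_eq[of zopt] sum_nonneg[of "{0..m}" "\<lambda>i. \<sigma>opt i zopt * ?G i zopt"] by force
  then have zero: "\<sigma>opt i zopt * ?G i zopt = 0" if "i \<in> {0..m}" for i
    using sum_nonneg_eq_0_iff[of "{0..m}" "\<lambda>i. \<sigma>opt i zopt * ?G i zopt"] nonneg that by simp
  have summand: "wirtinger (\<lambda>z. \<sigma>opt i z * ?G i z) zopt
      = complex_of_real (\<sigma>opt i zopt) *s wirtinger (?G i) zopt" if i: "i \<in> {0..m}" for i
  proof -
    \<comment> \<open>The product rule leaves this extra term. Either the constraint is active and
      the coefficient is 0, or complementarity makes \<open>\<sigma>opt i\<close> vanish at
      \<open>zopt\<close>, its global minimum, so its gradient is 0.\<close>
    have "complex_of_real (?G i zopt) *s wirtinger (\<sigma>opt i) zopt = 0"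
    proof (cases "?G i zopt = 0")
      case False
      then have "\<sigma>opt i zopt = 0" using zero[OF i] by simp
      then have "wirtinger (\<sigma>opt i) zopt = 0"
        using herm_sos_nonneg[OF sos[OF i]]
        by (intro wirtinger_global_min herm_sos_imp_real_cpoly sos i) simp
      then show ?thesis by simp
    qed simp
    then show ?thesis
      using wirtinger_mult[OF herm_sos_imp_real_cpoly[OF sos[OF i]] G[OF i]] by simp
  qed
  have prods: "(\<lambda>z. \<sigma>opt i z * ?G i z) \<in> real_cpoly" if "i \<in> {0..m}" for i
    using that by (intro real_cpoly_mult herm_sos_imp_real_cpoly sos G)
  have "wirtinger f zopt = wirtinger (\<lambda>z. lam + (\<Sum>i=0..m. \<sigma>opt i z * ?G i z)) zopt"
    using f_eq by (intro arg_cong[of _ _ "\<lambda>f. wirtinger f zopt"]) (rule ext)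
  also have "\<dots> = wirtinger (\<lambda>_. lam) zopt + wirtinger (\<lambda>z. \<Sum>i=0..m. \<sigma>opt i z * ?G i z) zopt"
    using prods by (intro wirtinger_add real_cpoly_const real_cpoly_sum)
  also have "\<dots> = (\<Sum>i=0..m. complex_of_real (\<sigma>opt i zopt) *s wirtinger (?G i) zopt)"
    using prods by (simp only: wirtinger_const wirtinger_sum[OF finite_atLeastAtMost] summand add_0_left cong: sum.cong)
  \<comment> \<open>The term of index 0 drops out because the constant 1 has zero gradient.\<close>
  also have "\<dots> = (\<Sum>i=1..m. complex_of_real (\<sigma>opt i zopt) *s wirtinger (g i) zopt)"
    by (simp add: sum.atLeast_Suc_atMost wirtinger_const)
  finally have "wirtinger f zopt = (\<Sum>i=1..m. complex_of_real (\<sigma>opt i zopt) *s wirtinger (g i) zopt)" .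
  moreover have "0 \<le> \<sigma>opt i zopt \<and> 0 \<le> g i zopt \<and> \<sigma>opt i zopt * g i zopt = 0" if "i \<in> {1..m}" for i
    using herm_sos_nonneg[OF sos, of i zopt] g_nonneg[of i] zero[of i] that by simp
  ultimately show ?thesis by blast
qed

end
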